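(* For every $0<\gamma<2$ there exist a strictly increasing sequence $(n_k)_{k\ge1}$ of positive integers and a real sequence $(c_k)_{k\ge1}$ such that $$\sum_{k=3}^\infty c_k^2(\log\log k)^\gamma<\infty,$$ but the series $\sum_{k=1}^\infty c_k\varphi(n_kx)$ diverges for almost every $x$.
   Context: $\varphi(x):=\{x\}-1/2$, where $\{x\}$ denotes the fractional part of the real number $x$. "Almost every" is with respect to Lebesgue measure. *)

theory Defs
  imports "HOL-Analysis.Analysis"
begin

definition varphi :: "real \<Rightarrow> real" where
  "varphi x = frac x - 1/2"

end

theory Submission
  imports Defs
begin

text \<open>
  Since \<open>\<integral> \<phi>(mx) \<phi>(nx) dx = gcd(m,n)\<^sup>2 / (12 m n)\<close>, the square norm of \<open>\<Sum> \<phi>(nx)\<close> over \<open>n \<in> S\<close> is a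
  GCD sum. Following Gal, take \<open>S\<close> to be all products of the primes \<open>p \<le> y\<close> with exponents at most \<open>m\<close>:
  with \<open>N = card S\<close> and \<open>\<theta> = 2m/(m+1)\<close> the GCD sum is at least a constant times
  \<open>N (log y)\<^sup>\<theta>\<close>, while \<open>log log N\<close> is at most \<open>log y + O(1)\<close>. Choosing \<open>m\<close> with \<open>\<theta> > \<gamma>\<close>, a normalised
  sum has an arbitrarily small weight \<open>\<Sum> c\<^sub>k\<^sup>2 (log log k)\<^sup>\<gamma>\<close>.

  The normalised sum may concentrate on a small set, so one first adds \<open>12 N\<close> of its dilates
  by rapidly increasing integers. These are almost independent, hence the fourth moment is controlled by the
  second one, and by Paley-Zygmund the sum exceeds \<open>1/2\<close> on a set of measure at least \<open>1/96\<close>. Finally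
  such blocks, with summable weights, are dilated by integers \<open>E\<^sub>i \<rightarrow> \<infinity>\<close> and put one after the other. A mixing
  property of \<open>x \<mapsto> D x\<close> modulo 1, uniform in the second function, shows that almost every \<open>x\<close> makes
  infinitely many block sums exceed \<open>1/2\<close>, against the Cauchy criterion.
\<close>

subsection \<open>Mixing of dilations\<close>

text \<open>Half-open, so that the integer translates tile the line and integrals over consecutive
  periods add up.\<close>

definition unit_interval :: "real measure" where
  "unit_interval = restrict_space lborel {0..<1}"

abbreviation mean :: "(real \<Rightarrow> real) \<Rightarrow> real" where
  "mean \<equiv> integral\<^sup>L unit_interval"

text \<open>Boundedness makes the class stable under products and powers while every member stays
  integrable over a period, so moments of any order exist automatically.\<close>

definition bper :: "(real \<Rightarrow> real) \<Rightarrow> bool" where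
  "bper f \<longleftrightarrow> f \<in> borel_measurable borel \<and> bounded (range f) \<and> (\<forall>x. f (x + 1) = f x)"

lemma space_unit_interval [simp]: "space unit_interval = {0..<1}"
  by (simp add: unit_interval_def space_restrict_space)

lemma emeasure_unit_interval: "emeasure unit_interval {0..<1} = 1"
  by (simp add: unit_interval_def emeasure_restrict_space)

interpretation unit_interval: finite_measure unit_interval
  by standard (simp add: emeasure_unit_interval)

lemma measure_unit_interval [simp]: "measure unit_interval {0..<1} = 1"
  by (simp add: measure_def emeasure_unit_interval)

lemma borel_measurable_unit_interval [measurable (raw)]:
  "f \<in> borel_measurable borel \<Longrightarrow> f \<in> borel_measurable unit_interval"
  unfolding unit_interval_def by (intro measurable_restrict_space1) simp

lemma sets_unit_interval: "A \<in> sets unit_interval \<Longrightarrow> A \<in> sets borel \<and> A \<subseteq> {0..<1}"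
  by (auto simp: unit_interval_def sets_restrict_space)

lemma mean_eq_set_integral: "mean f = (LINT x:{0..<1}|lborel. f x)"
  by (simp add: unit_interval_def integral_restrict_space set_lebesgue_integral_def)

section \<open>Closure properties of bounded periodic functions\<close>

lemma bper_measurable [measurable_dest]: "bper f \<Longrightarrow> f \<in> borel_measurable borel"
  by (simp add: bper_def)

lemma bper_bound:
  assumes "bper f"
  obtains B where "B > 0" "\<And>x. \<bar>f x\<bar> \<le> B"
proof -
  from assms obtain B where "\<forall>y\<in>range f. norm y \<le> B"
    by (auto simp: bper_def bounded_iff)
  then have "\<bar>f x\<bar> \<le> max B 1" for x by (auto intro: max.coboundedI1)
  then show ?thesis by (intro that[of "max B 1"]) auto
qed

lemma bperI:
  assumes "f \<in> borel_measurable borel" "\<And>x. \<bar>f x\<bar> \<le> B" "\<And>x. f (x + 1) = f x"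
  shows "bper f"
  using assms by (auto simp: bper_def bounded_iff)

lemma bper_const [simp]: "bper (\<lambda>x. c)"
  by (auto intro: bperI)

lemma bper_add [simp]:
  assumes "bper f" "bper g" shows "bper (\<lambda>x. f x + g x)"
proof -
  obtain B where "\<And>x. \<bar>f x\<bar> \<le> B" using bper_bound[OF assms(1)] by metis
  moreover obtain C where "\<And>x. \<bar>g x\<bar> \<le> C" using bper_bound[OF assms(2)] by metis
  ultimately have "\<bar>f x + g x\<bar> \<le> B + C" for x by (meson abs_triangle_ineq add_mono order_trans)
  then show ?thesis using assms by (intro bperI[where B = "B + C"]) (auto simp: bper_def)
qed

lemma bper_mult [simp]:
  assumes "bper f" "bper g" shows "bper (\<lambda>x. f x * g x)"
proof -
  obtain B where B: "\<And>x. \<bar>f x\<bar> \<le> B" using bper_bound[OF assms(1)] by metis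
  obtain C where C: "\<And>x. \<bar>g x\<bar> \<le> C" using bper_bound[OF assms(2)] by metis
  have "\<bar>f x * g x\<bar> \<le> B * C" for x unfolding abs_mult
    using B[of x] C[of x] by (intro mult_mono) auto
  then show ?thesis using assms by (intro bperI[where B = "B * C"]) (auto simp: bper_def)
qed

lemma bper_power [simp]: "bper f \<Longrightarrow> bper (\<lambda>x. f x ^ k)"
  by (induction k) auto

lemma bper_sum [simp]: "(\<And>i. i \<in> I \<Longrightarrow> bper (f i)) \<Longrightarrow> bper (\<lambda>x. \<Sum>i\<in>I. f i x)"
  by (induction I rule: infinite_finite_induct) auto

lemma bper_add_nat: "bper f \<Longrightarrow> f (x + real n) = f x"
proof (induction n)
  case (Suc n)
  then have "f (x + real (Suc n)) = f ((x + real n) + 1)" by (simp add: algebra_simps)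
  with Suc show ?case by (simp add: bper_def)
qed simp

lemma bper_dilate [simp]:
  assumes "bper f" shows "bper (\<lambda>x. f (real n * x))"
proof -
  have [measurable]: "f \<in> borel_measurable borel" using assms by (simp add: bper_def)
  obtain B where B: "\<And>x. \<bar>f x\<bar> \<le> B" using bper_bound[OF assms] by metis
  have "f (real n * (x + 1)) = f (real n * x)" for x
    using bper_add_nat[OF assms, of "real n * x" n] by (simp add: algebra_simps)
  with B show ?thesis by (intro bperI[where B = B]) auto
qed

lemma bper_shift [simp]:
  assumes "bper f" shows "bper (\<lambda>x. f (x + t))"
proof -
  have [measurable]: "f \<in> borel_measurable borel" using assms by (simp add: bper_def)
  obtain B where B: "\<And>x. \<bar>f x\<bar> \<le> B" using bper_bound[OF assms] by metis
  have "f (x + 1 + t) = f (x + t)" for x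
    using bper_add_nat[OF assms, of "x + t" 1] by (simp add: algebra_simps)
  with B show ?thesis by (intro bperI[where B = B]) auto
qed

lemma bper_indicator:
  assumes "bper f" "A \<in> sets borel"
  shows "bper (\<lambda>x. indicator A (f x))"
  using assms by (intro bperI[where B = 1]) (auto simp: bper_def indicator_def)

lemma bper_integrable [simp]:
  assumes "bper f" shows "integrable unit_interval f"
proof -
  obtain B where "\<And>x. \<bar>f x\<bar> \<le> B" using bper_bound[OF assms] by metis
  then show ?thesis using assms
    by (intro unit_interval.integrable_const_bound[where B = B]) (auto simp: bper_def intro!: borel_measurable_unit_interval)
qed

section \<open>Integrals over whole periods, dilations and translations\<close>

lemma bper_set_integrable:
  assumes "bper f" shows "set_integrable lborel {a..<b} f"
proof -
  have [measurable]: "f \<in> borel_measurable borel" using assms by (simp add: bper_def)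
  obtain B where "\<And>x. \<bar>f x\<bar> \<le> B" using bper_bound[OF assms] by metis
  then show ?thesis unfolding set_integrable_def
    by (intro integrableI_bounded_set_indicator[where B = B]) (auto, cases "a \<le> b", auto)
qed

lemma set_integral_concat:
  assumes "bper f" "a \<le> b" "b \<le> c"
  shows "(LINT x:{a..<c}|lborel. f x) = (LINT x:{a..<b}|lborel. f x) + (LINT x:{b..<c}|lborel. f x)"
proof -
  have "{a..<c} = {a..<b} \<union> {b..<c}" using assms by auto
  then show ?thesis
    by (simp only:) (intro set_integral_Un bper_set_integrable assms, auto)
qed

lemma set_integral_affine:
  assumes "D > 0"
  shows "(LINT x:{a..<b}|lborel. f (t + D * x)) = (1 / D) * (LINT x:{t + D * a..<t + D * b}|lborel. (f x :: real))"
proof -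
  have "(LINT x:{t + D * a..<t + D * b}|lborel. f x)
      = \<bar>D\<bar> *\<^sub>R (LINT x|lborel. indicator {t + D * a..<t + D * b} (t + D * x) *\<^sub>R f (t + D * x))"
    unfolding set_lebesgue_integral_def using assms by (intro lborel_integral_real_affine) auto
  also have "(\<lambda>x. indicator {t + D * a..<t + D * b} (t + D * x) *\<^sub>R f (t + D * x))
      = (\<lambda>x. indicator {a..<b} x *\<^sub>R f (t + D * x))"
    using assms by (auto simp: fun_eq_iff indicator_def)
  finally show ?thesis using assms by (simp add: set_lebesgue_integral_def)
qed

lemma set_integral_shift_nat:
  assumes "bper f"
  shows "(LINT x:{real n + a..<real n + b}|lborel. f x) = (LINT x:{a..<b}|lborel. f x)"
  using set_integral_affine[of 1 a b f "real n"] bper_add_nat[OF assms, of _ n]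
  by (simp add: add.commute)

lemma set_integral_periods:
  assumes "bper f"
  shows "(LINT x:{0..<real n}|lborel. f x) = real n * mean f"
proof (induction n)
  case 0
  then show ?case by (simp add: set_lebesgue_integral_def)
next
  case (Suc n)
  have "(LINT x:{0..<real (Suc n)}|lborel. f x)
      = (LINT x:{0..<real n}|lborel. f x) + (LINT x:{real n + 0..<real n + 1}|lborel. f x)"
    using set_integral_concat[OF assms, of 0 "real n" "real (Suc n)"] by (simp add: add.commute)
  with Suc show ?case
    by (simp only: set_integral_shift_nat[OF assms] mean_eq_set_integral) (simp add: algebra_simps)
qed

text \<open>The substitution \<open>y = n x\<close> stretches the unit interval to exactly
  \<open>n\<close> periods and contributes the factor \<open>1 / n\<close>.\<close>

lemma mean_dilate:
  assumes "bper f" "n > 0"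
  shows "mean (\<lambda>x. f (real n * x)) = mean f"
  using set_integral_affine[of "real n" 0 1 f 0] set_integral_periods[OF assms(1), of n] assms(2)
  by (simp add: mean_eq_set_integral)

text \<open>The part of the shifted interval that lies beyond 1 is moved back by one period.\<close>

lemma mean_shift:
  assumes "bper f" "0 \<le> t" "t \<le> 1"
  shows "mean (\<lambda>x. f (x + t)) = mean f"
proof -
  have "mean (\<lambda>x. f (x + t)) = (LINT x:{t..<1 + t}|lborel. f x)"
    using set_integral_affine[of 1 0 1 f t] by (simp add: mean_eq_set_integral add.commute)
  also have "\<dots> = (LINT x:{t..<1}|lborel. f x) + (LINT x:{0..<t}|lborel. f x)"
    using set_integral_concat[OF assms(1), of t 1 "1 + t"] assms
      set_integral_shift_nat[OF assms(1), of 1 0 t] by simp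
  also have "\<dots> = mean f"
    using set_integral_concat[OF assms(1), of 0 t 1] assms by (simp add: mean_eq_set_integral)
  finally show ?thesis .
qed

section \<open>Mixing of integrable functions, uniform in the dilated factor\<close>

lemma mean_abs_le:
  assumes "integrable unit_interval f" "\<And>x. \<bar>f x\<bar> \<le> B"
  shows "\<bar>mean f\<bar> \<le> B"
proof -
  have "\<bar>mean f\<bar> \<le> mean (\<lambda>x. \<bar>f x\<bar>)" by (rule integral_abs_bound)
  also have "\<dots> \<le> mean (\<lambda>x. B)" using assms by (intro integral_mono) auto
  finally show ?thesis by simp
qed

text \<open>The threshold \<open>D0\<close> must not depend on \<open>v\<close>: in the final step
  the functions \<open>v\<close> vary with the block while \<open>u\<close> stays fixed.\<close>
definition mixing :: "(real \<Rightarrow> real) \<Rightarrow> bool" where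
  "mixing u \<longleftrightarrow> integrable unit_interval u \<and>
     (\<forall>e>0. \<exists>D0. \<forall>D\<ge>D0. \<forall>v. bper v \<longrightarrow> (\<forall>x. \<bar>v x\<bar> \<le> 1) \<longrightarrow>
        \<bar>mean (\<lambda>x. u x * v (real D * x)) - mean u * mean v\<bar> \<le> e)"

lemma integrable_mult_bper:
  assumes "integrable unit_interval u" "bper v"
  shows "integrable unit_interval (\<lambda>x. u x * v x)"
proof -
  have [measurable]: "u \<in> borel_measurable unit_interval" "v \<in> borel_measurable unit_interval"
    using assms by (auto simp: bper_def intro: borel_measurable_unit_interval)
  obtain B where B: "B > 0" "\<And>x. \<bar>v x\<bar> \<le> B" using bper_bound[OF assms(2)] by metis
  show ?thesis
  proof (rule Bochner_Integration.integrable_bound)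
    show "integrable unit_interval (\<lambda>x. B * u x)" using assms by simp
    show "AE x in unit_interval. norm (u x * v x) \<le> norm (B * u x)"
      using B by (intro AE_I2) (simp add: abs_mult, metis abs_ge_zero mult.commute mult_right_mono)
  qed simp
qed

lemma mean_mult_le:
  assumes "integrable unit_interval u" "bper v" "\<And>x. \<bar>v x\<bar> \<le> 1"
  shows "\<bar>mean (\<lambda>x. u x * v x)\<bar> \<le> mean (\<lambda>x. \<bar>u x\<bar>)"
proof -
  have "\<bar>mean (\<lambda>x. u x * v x)\<bar> \<le> mean (\<lambda>x. \<bar>u x * v x\<bar>)" by (rule integral_abs_bound)
  also have "\<dots> \<le> mean (\<lambda>x. \<bar>u x\<bar>)"
    using assms by (intro integral_mono integrable_abs integrable_mult_bper)
      (auto simp: abs_mult intro: mult_left_le)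
  finally show ?thesis .
qed

text \<open>Mixing passes to L1 limits: replacing \<open>u\<close> by \<open>w\<close> changes each
  of the two terms by at most the L1 distance, for all \<open>D\<close> and all \<open>v\<close>
  with \<open>\<bar>v\<bar> \<le> 1\<close> at once. Hence the three parts
  \<open>e / 3\<close>.\<close>

lemma mixing_approx:
  assumes u: "integrable unit_interval u"
    and approx: "\<And>e. e > 0 \<Longrightarrow> \<exists>w. mixing w \<and> mean (\<lambda>x. \<bar>u x - w x\<bar>) \<le> e"
  shows "mixing u"
  unfolding mixing_def
proof (intro conjI allI impI)
  fix e :: real assume "e > 0"
  then obtain w where w: "mixing w" "mean (\<lambda>x. \<bar>u x - w x\<bar>) \<le> e / 3"
    using approx[of "e / 3"] by auto
  then have int: "integrable unit_interval w" by (simp add: mixing_def)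
  from w obtain D0 where D0: "\<And>D v. D \<ge> D0 \<Longrightarrow> bper v \<Longrightarrow> (\<And>x. \<bar>v x\<bar> \<le> 1) \<Longrightarrow>
        \<bar>mean (\<lambda>x. w x * v (real D * x)) - mean w * mean v\<bar> \<le> e / 3"
    using \<open>e > 0\<close> unfolding mixing_def by (metis divide_pos_pos zero_less_numeral)
  have "\<bar>mean (\<lambda>x. u x * v (real D * x)) - mean u * mean v\<bar> \<le> e"
    if D: "D \<ge> D0" "bper v" "\<And>x. \<bar>v x\<bar> \<le> 1" for D v
  proof -
    let ?v = "\<lambda>x. v (real D * x)"
    have bv: "bper ?v" using D by simp
    have "mean (\<lambda>x. (u x - w x) * ?v x) = mean (\<lambda>x. u x * ?v x) - mean (\<lambda>x. w x * ?v x)"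
      using u int bv by (simp add: left_diff_distrib integrable_mult_bper)
    moreover have "\<bar>mean (\<lambda>x. (u x - w x) * ?v x)\<bar> \<le> e / 3"
      using mean_mult_le[of "\<lambda>x. u x - w x" ?v] u int bv D w by auto
    moreover have "\<bar>mean (\<lambda>x. w x * ?v x) - mean w * mean v\<bar> \<le> e / 3"
      using D0 D by auto
    moreover have "\<bar>(mean u - mean w) * mean v\<bar> \<le> e / 3"
    proof -
      have "\<bar>mean u - mean w\<bar> \<le> mean (\<lambda>x. \<bar>u x - w x\<bar>)"
        using integral_abs_bound[of unit_interval "\<lambda>x. u x - w x"] u int by simp
      moreover have "\<bar>mean v\<bar> \<le> 1" using D by (intro mean_abs_le) auto
      ultimately show ?thesis using w(2) unfolding abs_mult
        by (meson abs_ge_zero mult_left_le order_trans)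
    qed
    ultimately show ?thesis unfolding left_diff_distrib[of "mean u" "mean w"] by linarith
  qed
  then show "\<exists>D0. \<forall>D\<ge>D0. \<forall>v. bper v \<longrightarrow> (\<forall>x. \<bar>v x\<bar> \<le> 1) \<longrightarrow>
        \<bar>mean (\<lambda>x. u x * v (real D * x)) - mean u * mean v\<bar> \<le> e" by blast
qed (rule u)

lemma mixing_linear:
  assumes "mixing u" "mixing w"
  shows "mixing (\<lambda>x. a * u x + w x)"
  unfolding mixing_def
proof (intro conjI allI impI)
  have u: "integrable unit_interval u" and w: "integrable unit_interval w"
    using assms by (auto simp: mixing_def)
  then show "integrable unit_interval (\<lambda>x. a * u x + w x)" by auto
  fix e :: real assume "e > 0"
  \<comment> \<open>The error of the combination is \<open>\<bar>a\<bar> * d + d\<close>, which this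
    choice turns into exactly \<open>e\<close>, also for \<open>a = 0\<close>.\<close>
  define d where "d = e / (\<bar>a\<bar> + 1)"
  have d: "d > 0" using \<open>e > 0\<close> by (simp add: d_def)
  have "\<bar>a\<bar> * d + d = (\<bar>a\<bar> + 1) * d" by (simp add: distrib_right)
  also have "\<dots> = e" unfolding d_def by simp
  finally have d_e: "\<bar>a\<bar> * d + d = e" .
  obtain D1 where D1: "\<And>D v. D \<ge> D1 \<Longrightarrow> bper v \<Longrightarrow> (\<And>x. \<bar>v x\<bar> \<le> 1) \<Longrightarrow>
        \<bar>mean (\<lambda>x. u x * v (real D * x)) - mean u * mean v\<bar> \<le> d"
    using assms(1) d unfolding mixing_def by metis
  obtain D2 where D2: "\<And>D v. D \<ge> D2 \<Longrightarrow> bper v \<Longrightarrow> (\<And>x. \<bar>v x\<bar> \<le> 1) \<Longrightarrow>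
        \<bar>mean (\<lambda>x. w x * v (real D * x)) - mean w * mean v\<bar> \<le> d"
    using assms(2) d unfolding mixing_def by metis
  have "\<bar>mean (\<lambda>x. (a * u x + w x) * v (real D * x)) - mean (\<lambda>x. a * u x + w x) * mean v\<bar> \<le> e"
    if D: "D \<ge> max D1 D2" "bper v" "\<And>x. \<bar>v x\<bar> \<le> 1" for D v
  proof -
    let ?v = "\<lambda>x. v (real D * x)"
    have bv: "bper ?v" using D by simp
    have "mean (\<lambda>x. (a * u x + w x) * ?v x) - mean (\<lambda>x. a * u x + w x) * mean v
        = a * (mean (\<lambda>x. u x * ?v x) - mean u * mean v) + (mean (\<lambda>x. w x * ?v x) - mean w * mean v)"
      using integrable_mult_bper[OF u bv] integrable_mult_bper[OF w bv] u w
      by (simp add: distrib_right mult.assoc right_diff_distrib)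
    also have "\<bar>\<dots>\<bar> \<le> \<bar>a\<bar> * d + d"
      using D1[of D v] D2[of D v] D
      by (intro order_trans[OF abs_triangle_ineq] add_mono) (auto simp: abs_mult intro: mult_left_mono)
    finally show ?thesis using d_e by simp
  qed
  then show "\<exists>D0. \<forall>D\<ge>D0. \<forall>v. bper v \<longrightarrow> (\<forall>x. \<bar>v x\<bar> \<le> 1) \<longrightarrow>
        \<bar>mean (\<lambda>x. (a * u x + w x) * v (real D * x)) - mean (\<lambda>x. a * u x + w x) * mean v\<bar> \<le> e" by blast
qed

lemma set_integral_one: "a \<le> b \<Longrightarrow> (LINT x:{a..<b}|lborel. 1) = (b - a :: real)"
  by (simp add: set_lebesgue_integral_def)

lemma set_integral_abs_le:
  assumes "bper v" "\<And>x. \<bar>v x\<bar> \<le> 1" "a \<le> b"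
  shows "\<bar>LINT x:{a..<b}|lborel. v x\<bar> \<le> b - a"
proof -
  have "\<bar>LINT x:{a..<b}|lborel. v x\<bar> \<le> (LINT x:{a..<b}|lborel. \<bar>v x\<bar>)"
    using set_integral_norm_bound[OF bper_set_integrable[OF assms(1)], of a b] by simp
  also have "\<dots> \<le> (LINT x:{a..<b}|lborel. 1)"
    using assms bper_set_integrable[OF assms(1)] bper_set_integrable[OF bper_const]
    by (intro set_integral_mono set_integrable_abs) auto
  finally show ?thesis using assms set_integral_one by simp
qed

text \<open>After the substitution \<open>y = D x\<close> the integral runs over an interval of
  length \<open>D * s\<close>: full periods, each contributing \<open>mean v\<close>, and a
  remainder of length at most 1. The total error is at most \<open>2 / D\<close>, whatever
  \<open>v\<close> is.\<close>

lemma mixing_lessThan: "mixing (indicator {..<a})"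
  unfolding mixing_def
proof (intro conjI allI impI)
  show "integrable unit_interval (indicat_real {..<a})"
    by (intro unit_interval.integrable_const_bound[where B = 1])
      (auto intro!: borel_measurable_unit_interval)
  fix e :: real assume "e > 0"
  \<comment> \<open>Clipping \<open>a\<close> to the unit interval: the half-line meets it in
    \<open>{0..<s}\<close>.\<close>
  define s where "s = max 0 (min 1 a)"
  have s: "0 \<le> s" "s \<le> 1" by (auto simp: s_def)
  have eq: "mean (\<lambda>x. indicator {..<a} x * f x) = (LINT x:{0..<s}|lborel. f x)" for f :: "real \<Rightarrow> real"
    unfolding mean_eq_set_integral set_lebesgue_integral_def
    by (intro Bochner_Integration.integral_cong) (auto simp: indicator_def s_def)
  have mean_s: "mean (indicator {..<a}) = s"
    using eq[of "\<lambda>_. 1"] set_integral_one[of 0 s] s by simp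
  have "\<bar>mean (\<lambda>x. indicator {..<a} x * v (real D * x)) - mean (indicator {..<a}) * mean v\<bar> \<le> e"
    if D: "D \<ge> nat \<lceil>2 / e\<rceil> + 1" "bper v" "\<And>x. \<bar>v x\<bar> \<le> 1" for D v
  proof -
    have "2 / e \<le> real (nat \<lceil>2 / e\<rceil>)" by (rule real_nat_ceiling_ge)
    also have "\<dots> \<le> real D" using D by linarith
    finally have De: "2 / D \<le> e" and D0: "D > 0"
      using D \<open>e > 0\<close> by (auto simp: field_simps)
    define k where "k = nat \<lfloor>D * s\<rfloor>"
    have k: "real k \<le> D * s" "D * s \<le> real k + 1" using s by (auto simp: k_def)
    have mv: "\<bar>mean v\<bar> \<le> 1" using D by (intro mean_abs_le) auto
    have "mean (\<lambda>x. indicator {..<a} x * v (real D * x)) = (1 / D) * (LINT x:{0..<D * s}|lborel. v x)"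
      using set_integral_affine[of "real D" 0 s v 0] D0 by (simp add: eq)
    also have "(LINT x:{0..<D * s}|lborel. v x) = k * mean v + (LINT x:{real k..<D * s}|lborel. v x)"
      using set_integral_concat[OF D(2), of 0 "real k" "D * s"] k set_integral_periods[OF D(2)] by simp
    finally have "mean (\<lambda>x. indicator {..<a} x * v (real D * x)) - s * mean v
       = (1 / D) * ((real k - D * s) * mean v + (LINT x:{real k..<D * s}|lborel. v x))"
      using D0 by (simp add: field_simps)
    also have "\<bar>\<dots>\<bar> \<le> (1 / D) * 2"
    proof -
      have "\<bar>(real k - D * s) * mean v\<bar> \<le> 1 * 1" unfolding abs_mult
        using k mv by (intro mult_mono) auto
      moreover have "\<bar>LINT x:{real k..<D * s}|lborel. v x\<bar> \<le> 1"
        using set_integral_abs_le[OF D(2,3) k(1)] k by linarith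
      ultimately have "\<bar>(real k - D * s) * mean v + (LINT x:{real k..<D * s}|lborel. v x)\<bar> \<le> 2"
        by linarith
      then show ?thesis by (simp add: abs_mult divide_right_mono)
    qed
    finally show ?thesis using De mean_s by simp
  qed
  then show "\<exists>D0. \<forall>D\<ge>D0. \<forall>v. bper v \<longrightarrow> (\<forall>x. \<bar>v x\<bar> \<le> 1) \<longrightarrow>
     \<bar>mean (\<lambda>x. indicator {..<a} x * v (real D * x)) - mean (indicator {..<a}) * mean v\<bar> \<le> e" by blast
qed

lemma mixing_const: "mixing (\<lambda>x. c)"
proof -
  have "\<bar>mean (\<lambda>x. c * v (real D * x)) - c * mean v\<bar> \<le> e" if "bper v" "D \<ge> 1" "e > 0" for e :: real and v D
    using that mean_dilate[of v D] by simp
  then show ?thesis unfolding mixing_def by (auto intro!: exI[of _ 1])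
qed

text \<open>A Dynkin system argument from the intersection-stable generator of open half-lines.
  Complements follow by linearity, countable disjoint unions by L1 approximation with finite partial
  unions.\<close>

lemma mixing_indicator:
  assumes "A \<in> sets (borel :: real measure)"
  shows "mixing (indicator A)"
proof -
  have int: "integrable unit_interval (indicat_real A)" if "A \<in> sets borel" for A
    using that by (intro unit_interval.integrable_const_bound[where B = 1])
      (auto intro!: borel_measurable_unit_interval)
  have "{..<a} \<inter> {..<b} = {..<min a b}" for a b :: real by auto
  then have stable: "Int_stable (range (lessThan :: real \<Rightarrow> _))"
    unfolding Int_stable_def by auto
  have subset: "range (lessThan :: real \<Rightarrow> _) \<subseteq> Pow UNIV" by auto
  have borel: "sets borel = sigma_sets UNIV (range (lessThan :: real \<Rightarrow> _))"
    unfolding borel_Iio by simp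
  show ?thesis using assms unfolding borel
  proof (induction rule: sigma_sets_induct_disjoint[OF stable subset, consumes 1, case_names basic empty compl union])
    case (basic A)
    then show ?case by (auto simp: mixing_lessThan)
  next
    case empty
    then show ?case using mixing_const[of 0] by simp
  next
    case (compl A)
    have "indicat_real (UNIV - A) = (\<lambda>x. (-1) * indicat_real A x + 1)" by (auto simp: indicator_def)
    with mixing_linear[OF compl(2) mixing_const, of "-1" 1] show ?case by simp
  next
    case (union A)
    then have A[measurable]: "\<And>i. A i \<in> sets borel" unfolding borel by auto
    have part: "mixing (\<lambda>x. \<Sum>i<n. indicat_real (A i) x)" for n
    proof (induction n)
      case 0
      then show ?case using mixing_const[of 0] by simp
    next
      case (Suc n)
      with mixing_linear[OF union(3)[of n] this, of 1] show ?case by (simp add: add.commute)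
    qed
    have U: "(\<lambda>x. \<Sum>i<n. indicat_real (A i) x) = indicat_real (\<Union>i<n. A i)" for n
      using union(1) by (intro ext indicator_UN_disjoint[symmetric]) (auto simp: disjoint_family_on_def)
    have lim: "(\<lambda>n. mean (\<lambda>x. \<bar>indicat_real (\<Union>i. A i) x - indicat_real (\<Union>i<n. A i) x\<bar>)) \<longlonglongrightarrow> mean (\<lambda>x. 0)"
    proof (rule integral_dominated_convergence[where w = "\<lambda>_. 1"])
      show "AE x in unit_interval. (\<lambda>n. \<bar>indicat_real (\<Union>i. A i) x - indicat_real (\<Union>i<n. A i) x\<bar>) \<longlonglongrightarrow> 0"
      proof (rule AE_I2)
        fix x :: real
        have "(\<lambda>n. \<bar>indicat_real (\<Union>i. A i) x - indicat_real (\<Union>i<n. A i) x\<bar>) \<longlonglongrightarrow> \<bar>indicat_real (\<Union>i. A i) x - indicat_real (\<Union>i. A i) x\<bar>"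
          by (intro tendsto_intros LIMSEQ_indicator_UN)
        then show "(\<lambda>n. \<bar>indicat_real (\<Union>i. A i) x - indicat_real (\<Union>i<n. A i) x\<bar>) \<longlonglongrightarrow> 0" by simp
      qed
    qed (auto intro!: borel_measurable_unit_interval simp: indicator_def)
    show ?case
    proof (rule mixing_approx)
      fix e :: real assume "e > 0"
      with LIMSEQ_D[OF lim] obtain n where
        "\<bar>mean (\<lambda>x. \<bar>indicat_real (\<Union>i. A i) x - indicat_real (\<Union>i<n. A i) x\<bar>) - mean (\<lambda>x. 0)\<bar> < e"
        unfolding real_norm_def by blast
      then show "\<exists>w. mixing w \<and> mean (\<lambda>x. \<bar>indicat_real (\<Union> (range A)) x - w x\<bar>) \<le> e"
        using part[of n] unfolding U by (intro exI[of _ "indicat_real (\<Union>i<n. A i)"]) auto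
    qed (auto intro!: int)
  qed
qed

text \<open>The usual passage from indicators through simple functions to L1 limits.\<close>

theorem integrable_mixing:
  assumes "integrable unit_interval u"
  shows "mixing u"
  using assms
proof (induction rule: integrable_induct)
  case (base A c)
  then have "A \<in> sets borel" using sets_unit_interval by blast
  from mixing_linear[OF mixing_indicator[OF this] mixing_const[of 0], of c]
  show ?case by (simp add: mult.commute)
next
  case (add f g)
  then show ?case using mixing_linear[of f g 1] by simp
next
  case (lim f s)
  have lim': "(\<lambda>n. mean (\<lambda>x. \<bar>f x - s n x\<bar>)) \<longlonglongrightarrow> mean (\<lambda>x. 0)"
  \<comment> \<open>The induction rule supplies approximants with
    \<open>\<bar>s n x\<bar> \<le> 2 * \<bar>f x\<bar>\<close>, which gives the factor 3.\<close>
  proof (rule integral_dominated_convergence[where w = "\<lambda>x. 3 * \<bar>f x\<bar>"])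
    show "AE x in unit_interval. (\<lambda>n. \<bar>f x - s n x\<bar>) \<longlonglongrightarrow> 0"
    proof (rule AE_I2)
      fix x :: real assume "x \<in> space unit_interval"
      then have "(\<lambda>n. \<bar>f x - s n x\<bar>) \<longlonglongrightarrow> \<bar>f x - f x\<bar>"
        by (intro tendsto_intros lim)
      then show "(\<lambda>n. \<bar>f x - s n x\<bar>) \<longlonglongrightarrow> 0" by simp
    qed
    show "AE x in unit_interval. norm \<bar>f x - s n x\<bar> \<le> 3 * \<bar>f x\<bar>" for n
      using lim(3) by (intro AE_I2) (force intro: order_trans[OF abs_triangle_ineq4])
  qed (use lim in auto)
  show ?case
  proof (rule mixing_approx)
    fix e :: real assume "e > 0"
    with LIMSEQ_D[OF lim'] obtain n where
      "\<bar>mean (\<lambda>x. \<bar>f x - s n x\<bar>) - mean (\<lambda>x. 0)\<bar> < e"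
      unfolding real_norm_def by blast
    then show "\<exists>w. mixing w \<and> mean (\<lambda>x. \<bar>f x - w x\<bar>) \<le> e"
      using lim(5)[of n] by (intro exI[of _ "s n"]) auto
  qed (use lim in auto)
qed

subsection \<open>Correlations of the sawtooth function\<close>

lemma varphi_bound: "\<bar>varphi x\<bar> \<le> 1 / 2"
  using frac_ge_0[of x] frac_lt_1[of x] unfolding varphi_def by linarith

lemma bper_varphi [simp]: "bper varphi"
proof (rule bperI)
  have eq: "varphi = (\<lambda>x. x - real_of_int \<lfloor>x\<rfloor> - 1 / 2)" by (simp add: varphi_def frac_def fun_eq_iff)
  show "varphi \<in> borel_measurable borel" unfolding eq by measurable
  show "\<bar>varphi x\<bar> \<le> 1 / 2" for x by (rule varphi_bound)
qed (simp add: varphi_def frac_1_eq)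

lemma varphi_add_nat [simp]: "varphi (x + real k) = varphi x"
  by (rule bper_add_nat) simp

lemma mean_power_varphi:
  "mean (\<lambda>x. varphi x ^ k) = ((1/2) ^ (k + 1) - (-1/2) ^ (k + 1)) / (k + 1)"
proof -
  have "has_bochner_integral lborel (\<lambda>x. indicator {0..1} x *\<^sub>R (x - 1/2) ^ k)
     ((\<lambda>x. (x - 1/2) ^ (k + 1) / (k + 1)) 1 - (\<lambda>x. (x - 1/2) ^ (k + 1) / (k + 1)) (0::real))"
    by (rule has_bochner_integral_FTC_Icc)
       (auto simp: has_real_derivative_iff_has_vector_derivative[symmetric] simp del: power_Suc
             intro!: derivative_eq_intros continuous_intros)
  then have "(LINT x|lborel. indicator {0..1} x *\<^sub>R (x - 1/2) ^ k)
    = ((1/2) ^ (k + 1) - (-1/2) ^ (k + 1)) / (k + 1)"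
    by (simp add: has_bochner_integral_iff add_divide_distrib algebra_simps)
  moreover have "mean (\<lambda>x. varphi x ^ k) = (LINT x|lborel. indicator {0..1} x *\<^sub>R (x - 1/2) ^ k)"
    unfolding mean_eq_set_integral set_lebesgue_integral_def
  proof (rule integral_cong_AE)
    have [measurable]: "varphi \<in> borel_measurable borel" by (rule bper_measurable) simp
    show "(\<lambda>x. indicat_real {0..<1} x *\<^sub>R varphi x ^ k) \<in> borel_measurable lborel" by simp
    \<comment> \<open>The two integrands can differ only at the endpoint 1, where the sawtooth
      jumps.\<close>
    show "AE x in lborel. indicat_real {0..<1} x *\<^sub>R varphi x ^ k = indicat_real {0..1} x *\<^sub>R (x - 1/2) ^ k"
      using AE_lborel_singleton[of "1 :: real"]
      by eventually_elim (auto simp: indicator_def varphi_def)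
  qed simp
  ultimately show ?thesis by simp
qed

lemma mean_varphi [simp]: "mean varphi = 0"
  using mean_power_varphi[of 1] by (simp add: power2_eq_square)

lemma mean_varphi_sq: "mean (\<lambda>x. varphi x ^ 2) = 1 / 12"
  using mean_power_varphi[of 2] by (simp add: power3_eq_cube)

section \<open>The distribution relation of the sawtooth and the correlations it yields\<close>

text \<open>A shift by \<open>1 / n\<close> permutes the summands cyclically: the one pushed out at
  \<open>j = n\<close> re-enters at \<open>j = 0\<close> by periodicity.\<close>

lemma sum_varphi_shift_aux:
  assumes "n > 0"
  shows "(\<Sum>j<n. varphi (y + 1 / n + real j / n)) = (\<Sum>j<n. varphi (y + real j / n))"
proof -
  from assms obtain m where n: "n = Suc m" by (cases n) auto
  have "(\<Sum>j<n. varphi (y + 1 / n + real j / n)) = (\<Sum>j<n. varphi (y + real (Suc j) / n))"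
    by (simp add: add_divide_distrib algebra_simps)
  also have "\<dots> = (\<Sum>j<m. varphi (y + real (Suc j) / n)) + varphi (y + real n / n)"
    by (simp add: n)
  also have "varphi (y + real n / n) = varphi (y + real 0 / n)"
    using assms varphi_add_nat[of y 1] by simp
  also have "(\<Sum>j<m. varphi (y + real (Suc j) / n)) + varphi (y + real 0 / n) = (\<Sum>j<n. varphi (y + real j / n))"
    using sum.lessThan_Suc_shift[of "\<lambda>j. varphi (y + real j / n)" m] by (simp add: n add.commute)
  finally show ?thesis .
qed

text \<open>The difference \<open>g\<close> of the two sides has period \<open>1 / n\<close>, so it
  suffices to check one such period. On \<open>{0..<1 / n}\<close> no summand wraps around and the
  sum is an arithmetic progression.\<close>

lemma sum_varphi_shift:
  assumes "n > 0"
  shows "(\<Sum>j<n. varphi (y + real j / n)) = varphi (real n * y)"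
proof -
  define g where "g y = (\<Sum>j<n. varphi (y + real j / n)) - varphi (real n * y)" for y
  have step: "g (y + 1 / n) = g y" for y
    using sum_varphi_shift_aux[OF assms, of y] varphi_add_nat[of "real n * y" 1] assms
    by (simp add: g_def distrib_left)
  have steps: "g (y + real k / n) = g y" for y k
  proof (induction k)
    case (Suc k)
    then show ?case using step[of "y + real k / n"] by (simp add: add_divide_distrib algebra_simps)
  qed simp
  have g_int: "g (y + of_int i / n) = g y" for y i
  proof (cases i)
    case (nonneg k)
    then show ?thesis using steps[of y k] by simp
  next
    case (neg k)
    then show ?thesis using steps[of "y + of_int i / n" "Suc k"] by (simp add: add_divide_distrib[symmetric] add.assoc)
  qed
  \<comment> \<open>The representative of \<open>y\<close> modulo \<open>1 / n\<close> in the basic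
    period.\<close>
  define z where "z = frac (real n * y) / n"
  have z: "0 \<le> z" "z < 1 / n" using assms frac_lt_1[of "real n * y"] by (auto simp: z_def divide_strict_right_mono)
  have "y = z + of_int \<lfloor>real n * y\<rfloor> / n"
    using assms by (simp add: z_def frac_def field_simps)
  then have "g y = g z" using g_int[of z "\<lfloor>real n * y\<rfloor>"] by simp
  also have "g z = 0"
  proof -
    have "varphi (z + real j / n) = z + real j / n - 1 / 2" if "j < n" for j
    proof -
      have "z + real j / n < 1 / n + real j / n" using z by simp
      also have "\<dots> = real (Suc j) / n" by (simp add: add_divide_distrib)
      also have "\<dots> \<le> 1" using that assms by simp
      finally show ?thesis unfolding varphi_def using z by (subst frac_eq[THEN iffD2]) auto
    qed
    then have "(\<Sum>j<n. varphi (z + real j / n)) = (\<Sum>j<n. z - 1 / 2 + real j / n)"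
      by (intro sum.cong) auto
    also have "\<dots> = real n * (z - 1 / 2) + (\<Sum>j<n. real j) / n"
      by (simp add: sum.distrib sum_divide_distrib)
    also have "(\<Sum>j<n. real j) = real n * (real n - 1) / 2"
      by (induction n) (auto simp: field_simps)
    also have "real n * (z - 1 / 2) + real n * (real n - 1) / 2 / n = real n * z - 1 / 2"
      using assms by (simp add: field_simps)
    also have "\<dots> = varphi (real n * z)"
      unfolding varphi_def using z assms by (subst frac_eq[THEN iffD2]) (auto simp: field_simps)
    finally show ?thesis by (simp add: g_def)
  qed
  finally show ?thesis by (simp add: g_def)
qed

text \<open>Multiplication by \<open>m\<close> permutes the residues modulo \<open>n\<close>, so the
  shifts are those of the distribution relation in another order.\<close>

lemma sum_varphi_shift_coprime:
  assumes "n > 0" "coprime m n"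
  shows "(\<Sum>j<n. varphi (y + real (m * j) / n)) = varphi (real n * y)"
proof -
  have "varphi (y + real (m * j) / n) = varphi (y + real ((m * j) mod n) / n)" for j
  proof -
    have "m * j = (m * j) mod n + (m * j) div n * n" by simp
    then have "real (m * j) = real ((m * j) mod n) + real ((m * j) div n) * real n"
      by (metis of_nat_add of_nat_mult)
    then have "y + real (m * j) / n = y + real ((m * j) mod n) / n + real ((m * j) div n)"
      using assms by (simp add: field_simps)
    then show ?thesis using varphi_add_nat[of "y + real ((m * j) mod n) / n"] by (simp only:)
  qed
  then have "(\<Sum>j<n. varphi (y + real (m * j) / n)) = (\<Sum>j<n. varphi (y + real ((m * j) mod n) / n))" by simp
  also have "\<dots> = (\<Sum>j<n. varphi (y + real j / n))"
  proof (rule sum.reindex_bij_betw)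
    have "inj_on (\<lambda>j. m * j mod n) {..<n}"
    proof (rule linorder_inj_onI)
      fix i j assume "i < j" "j \<in> {..<n}"
      have False if "m * i mod n = m * j mod n"
      proof -
        have "n dvd m * j - m * i"
          using that \<open>i < j\<close> by (subst mod_eq_dvd_iff_nat[symmetric]) auto
        then have "n dvd m * (j - i)" by (simp add: right_diff_distrib')
        then have "n dvd j - i" using assms(2) by (simp add: coprime_commute coprime_dvd_mult_right_iff)
        then show False using \<open>i < j\<close> \<open>j \<in> {..<n}\<close> by (auto dest: dvd_imp_le)
      qed
      then show "m * i mod n \<noteq> m * j mod n" by blast
    qed auto
    moreover have "(\<lambda>j. m * j mod n) ` {..<n} \<subseteq> {..<n}" using assms by auto
    ultimately show "bij_betw (\<lambda>j. m * j mod n) {..<n} {..<n}"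
      by (simp add: bij_betw_def endo_inj_surj)
  qed
  finally show ?thesis using sum_varphi_shift[OF assms(1)] by simp
qed

lemma mean_avg_shift:
  assumes "bper f" "n > 0"
  shows "mean f = mean (\<lambda>x. \<Sum>j<n. f (x + real j / n)) / n"
proof -
  have "mean (\<lambda>x. \<Sum>j<n. f (x + real j / n)) = (\<Sum>j<n. mean (\<lambda>x. f (x + real j / n)))"
    using assms by (intro Bochner_Integration.integral_sum) simp
  also have "\<dots> = (\<Sum>j<n. mean f)" using assms by (intro sum.cong mean_shift) auto
  finally show ?thesis using assms by simp
qed

text \<open>Average over the shifts \<open>j / n\<close>. They leave \<open>varphi (n x)\<close>
  unchanged, while the other factor sums to \<open>varphi (n m x)\<close>. The result depends on
  \<open>n x\<close> only, so the dilation by \<open>n\<close> drops out.\<close>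

lemma mean_varphi_coprime:
  assumes "m > 0" "n > 0" "coprime m n"
  shows "mean (\<lambda>x. varphi (real m * x) * varphi (real n * x)) = mean (\<lambda>x. varphi (real m * x) * varphi x) / n"
proof -
  have "mean (\<lambda>x. varphi (real m * x) * varphi (real n * x))
      = mean (\<lambda>x. \<Sum>j<n. varphi (real m * (x + real j / n)) * varphi (real n * (x + real j / n))) / n"
    by (intro mean_avg_shift bper_mult bper_dilate assms) simp_all
  also have "(\<lambda>x. \<Sum>j<n. varphi (real m * (x + real j / n)) * varphi (real n * (x + real j / n)))
     = (\<lambda>x. varphi (real m * (real n * x)) * varphi (real n * x))"
  proof
    fix x
    have "(\<Sum>j<n. varphi (real m * (x + real j / n)) * varphi (real n * (x + real j / n)))
       = (\<Sum>j<n. varphi (real m * x + real (m * j) / n) * varphi (real n * x))"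
      using assms varphi_add_nat[of "real n * x"] by (intro sum.cong) (auto simp: distrib_left)
    also have "\<dots> = varphi (real n * (real m * x)) * varphi (real n * x)"
      using sum_varphi_shift_coprime[OF assms(2,3), of "real m * x"] by (simp add: sum_distrib_right[symmetric])
    finally show "(\<Sum>j<n. varphi (real m * (x + real j / n)) * varphi (real n * (x + real j / n)))
       = varphi (real m * (real n * x)) * varphi (real n * x)" by (simp add: mult.left_commute)
  qed
  also have "mean (\<lambda>x. varphi (real m * (real n * x)) * varphi (real n * x)) = mean (\<lambda>x. varphi (real m * x) * varphi x)"
    by (rule mean_dilate[of "\<lambda>x. varphi (real m * x) * varphi x"]) (use assms in simp_all)
  finally show ?thesis .
qed

text \<open>The gcd is removed as a common dilation. The coprime reduction is then applied once to
  each factor and leaves the second moment \<open>1 / 12\<close> divided by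
  \<open>a * b\<close>.\<close>

theorem mean_varphi_mult:
  assumes "m > 0" "n > 0"
  shows "mean (\<lambda>x. varphi (real m * x) * varphi (real n * x)) = real (gcd m n) ^ 2 / (12 * real m * real n)"
proof -
  define d where "d = gcd m n"
  obtain a b where ab: "m = a * d" "n = b * d" "coprime a b"
    using gcd_coprime_exists[of m n] assms unfolding d_def by (metis gcd_pos_nat neq0_conv)
  have pos: "a > 0" "b > 0" "d > 0" using ab assms by (auto intro: gr0I)
  have "mean (\<lambda>x. varphi (real m * x) * varphi (real n * x))
      = mean (\<lambda>x. varphi (real a * (real d * x)) * varphi (real b * (real d * x)))"
    by (simp add: ab mult.assoc)
  also have "\<dots> = mean (\<lambda>x. varphi (real a * x) * varphi (real b * x))"
    by (rule mean_dilate[of "\<lambda>x. varphi (real a * x) * varphi (real b * x)"]) (use pos in simp_all)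
  also have "\<dots> = mean (\<lambda>x. varphi (real a * x) * varphi x) / b"
    using mean_varphi_coprime ab pos by blast
  also have "mean (\<lambda>x. varphi (real a * x) * varphi x) = mean (\<lambda>x. varphi (real 1 * x) * varphi (real a * x))"
    by (simp add: mult.commute)
  also have "\<dots> = mean (\<lambda>x. varphi (real 1 * x) * varphi x) / a"
    using mean_varphi_coprime[of 1 a] pos by simp
  also have "\<dots> = 1 / 12 / a" by (simp add: mean_varphi_sq[unfolded power2_eq_square])
  also have "1 / 12 / a / b = real d ^ 2 / (12 * real m * real n)"
    using pos by (simp add: ab power2_eq_square)
  finally show ?thesis by (simp add: d_def)
qed

subsection \<open>Large GCD sums\<close>

text \<open>Normalised so that each diagonal term is 1 (for positive elements).\<close>

definition gcd_sum :: "nat set \<Rightarrow> real" where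
  "gcd_sum S = (\<Sum>a\<in>S. \<Sum>b\<in>S. real (gcd a b) ^ 2 / (real a * real b))"

text \<open>The summand is \<open>p\<close> to the power \<open>-\<bar>i - j\<bar>\<close>. The
  \<open>m + 1\<close> diagonal terms give 1 each and the \<open>2 * m\<close> terms next to the
  diagonal give \<open>1 / p\<close> each; the rest is discarded.\<close>

lemma local_gcd_sum:
  fixes p :: nat
  assumes "p > 0"
  shows "real m + 1 + 2 * real m / real p \<le> (\<Sum>i\<le>m. \<Sum>j\<le>m. real p ^ (2 * min i j) / real p ^ (i + j))"
proof (induction m)
  case (Suc m)
  let ?f = "\<lambda>i j. real p ^ (2 * min i j) / real p ^ (i + j)"
  have "1 / real p = ?f m (Suc m)" using assms by (simp add: mult_2 power_add)
  also have "\<dots> \<le> (\<Sum>i\<le>m. ?f i (Suc m))" by (rule member_le_sum) auto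
  finally have 1: "1 / real p \<le> (\<Sum>i\<le>m. ?f i (Suc m))" .
  have 2: "(\<Sum>i\<le>m. ?f i (Suc m)) = (\<Sum>i\<le>m. ?f (Suc m) i)"
    by (simp add: min.commute add.commute)
  have 3: "?f (Suc m) (Suc m) = 1" using assms by (simp add: mult_2)
  have "(\<Sum>i\<le>Suc m. \<Sum>j\<le>Suc m. ?f i j)
     = (\<Sum>i\<le>m. \<Sum>j\<le>m. ?f i j) + (\<Sum>i\<le>m. ?f i (Suc m)) + ((\<Sum>i\<le>m. ?f (Suc m) i) + ?f (Suc m) (Suc m))"
    by (simp only: sum.atMost_Suc sum.distrib)
  with Suc 1 2 3 show ?case by (simp add: add_divide_distrib distrib_left)
qed simp

lemma gcd_prime_power_mult:
  fixes p a b :: nat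
  assumes "prime p" "\<not> p dvd a" "\<not> p dvd b"
  shows "gcd (p ^ i * a) (p ^ j * b) = p ^ min i j * gcd a b"
proof -
  have *: "gcd (p ^ i * a) (p ^ j * b) = p ^ i * gcd a b" if "i \<le> j" "\<not> p dvd a" for i j a b
  proof -
    have "p ^ j = p ^ i * p ^ (j - i)" using that by (simp add: power_add[symmetric])
    then have "gcd (p ^ i * a) (p ^ j * b) = p ^ i * gcd a (p ^ (j - i) * b)"
      by (simp add: mult.assoc gcd_mult_distrib_nat)
    also have "gcd a (p ^ (j - i) * b) = gcd a b"
      using prime_imp_coprime[OF assms(1) that(2)] coprime_commute
      by (intro gcd_mult_right_left_cancel) (simp add: coprime_commute)
    finally show ?thesis .
  qed
  show ?thesis
  proof (cases "i \<le> j")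
    case True
    then show ?thesis using *[OF True assms(2)] by (simp add: min_def)
  next
    case False
    then show ?thesis using *[of j i b a] assms(3) by (simp add: min_def gcd.commute)
  qed
qed

lemma inj_on_prime_power_mult:
  fixes p :: nat
  assumes "prime p" "\<And>a. a \<in> S \<Longrightarrow> \<not> p dvd a"
  shows "inj_on (\<lambda>(i, a). p ^ i * a) (I \<times> S)"
proof (rule inj_onI, clarify)
  fix i j a b assume ab: "a \<in> S" "b \<in> S" and eq: "p ^ i * a = p ^ j * b"
  have "multiplicity p (p ^ k * c) = k" if "c \<in> S" for k c
    using assms that by (intro multiplicity_decomposeI) (auto simp: prime_gt_0_nat prime_nat_iff)
  with eq ab have "i = j" by metis
  with eq assms(1) show "i = j \<and> a = b" by (auto simp: prime_gt_0_nat)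
qed

text \<open>Every summand splits into its \<open>p\<close>-part and its prime-to-\<open>p\<close>
  part, so the double sum factors.\<close>

lemma gcd_sum_prime_power_mult:
  assumes "prime p" "\<And>a. a \<in> S \<Longrightarrow> \<not> p dvd a" "finite S"
  shows "gcd_sum ((\<lambda>(i, a). p ^ i * a) ` ({..m} \<times> S))
    = (\<Sum>i\<le>m. \<Sum>j\<le>m. real p ^ (2 * min i j) / real p ^ (i + j)) * gcd_sum S"
proof -
  note inj = inj_on_prime_power_mult[OF assms(1,2), where I = "{..m}"]
  have "gcd_sum ((\<lambda>(i, a). p ^ i * a) ` ({..m} \<times> S))
    = (\<Sum>i\<le>m. \<Sum>a\<in>S. \<Sum>j\<le>m. \<Sum>b\<in>S. real (gcd (p ^ i * a) (p ^ j * b)) ^ 2 / (real (p ^ i * a) * real (p ^ j * b)))"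
    by (simp only: gcd_sum_def sum.reindex[OF inj] comp_def sum.cartesian_product' split_conv)
  also have "\<dots> = (\<Sum>i\<le>m. \<Sum>a\<in>S. \<Sum>j\<le>m. \<Sum>b\<in>S. (real p ^ (2 * min i j) / real p ^ (i + j)) * (real (gcd a b) ^ 2 / (real a * real b)))"
  proof (intro sum.cong refl)
    fix i a j b assume "a \<in> S" "b \<in> S"
    then have "real (gcd (p ^ i * a) (p ^ j * b)) = real p ^ min i j * real (gcd a b)"
      using gcd_prime_power_mult[OF assms(1), of a b i j] assms(2) by simp
    then show "real (gcd (p ^ i * a) (p ^ j * b)) ^ 2 / (real (p ^ i * a) * real (p ^ j * b))
       = (real p ^ (2 * min i j) / real p ^ (i + j)) * (real (gcd a b) ^ 2 / (real a * real b))"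
      by (simp add: power_mult_distrib power_even_eq power_add mult_ac)
  qed
  also have "\<dots> = (\<Sum>i\<le>m. \<Sum>j\<le>m. \<Sum>a\<in>S. \<Sum>b\<in>S. (real p ^ (2 * min i j) / real p ^ (i + j)) * (real (gcd a b) ^ 2 / (real a * real b)))"
    by (intro sum.cong[OF refl]) (rule sum.swap)
  also have "\<dots> = (\<Sum>i\<le>m. \<Sum>j\<le>m. real p ^ (2 * min i j) / real p ^ (i + j) * gcd_sum S)"
    by (simp only: gcd_sum_def sum_distrib_left)
  also have "\<dots> = (\<Sum>i\<le>m. \<Sum>j\<le>m. real p ^ (2 * min i j) / real p ^ (i + j)) * gcd_sum S"
    by (simp only: sum_distrib_right)
  finally show ?thesis .
qed

text \<open>Adjoining a prime \<open>p\<close> multiplies the cardinality by \<open>m + 1\<close>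
  and the GCD sum by a local factor of at least \<open>(m + 1) * (1 + \<theta> / p)\<close>. The
  clause on prime divisors is carried along so that a new prime divides no old element.\<close>

lemma gcd_sum_prime_product:
  assumes "finite P" "\<And>p. p \<in> P \<Longrightarrow> prime p"
  shows "\<exists>S. finite S \<and> 0 \<notin> S \<and> card S = (m + 1) ^ card P \<and> (\<forall>q a. prime q \<longrightarrow> a \<in> S \<longrightarrow> q dvd a \<longrightarrow> q \<in> P) \<and>
    gcd_sum S \<ge> real (card S) * (\<Prod>p\<in>P. 1 + (2 * real m / (real m + 1)) / real p)"
  using assms
proof (induction P rule: finite_induct)
  case empty
  show ?case by (rule exI[of _ "{1}"]) (auto simp: gcd_sum_def)
next
  case (insert p P)
  define \<theta> where "\<theta> = 2 * real m / (real m + 1)"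
  have p: "prime p" using insert by auto
  note IH = insert.IH[OF insert.prems[OF insertI2], folded \<theta>_def]
  then obtain S where S: "finite S" "0 \<notin> S" "card S = (m + 1) ^ card P"
    "\<forall>q a. prime q \<longrightarrow> a \<in> S \<longrightarrow> q dvd a \<longrightarrow> q \<in> P"
    "gcd_sum S \<ge> real (card S) * (\<Prod>p\<in>P. 1 + \<theta> / real p)"
    by blast
  have nd: "\<not> p dvd a" if "a \<in> S" for a using S(4) p that insert.hyps by blast
  define T where "T = (\<lambda>(i, a). p ^ i * a) ` ({..m} \<times> S)"
  have cardT: "card T = (m + 1) * card S"
    unfolding T_def by (subst card_image[OF inj_on_prime_power_mult[OF p nd]]) (auto simp: card_cartesian_product)
  have "real (card T) * (\<Prod>p\<in>insert p P. 1 + \<theta> / real p)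
      = (real m + 1) * (1 + \<theta> / real p) * (real (card S) * (\<Prod>p\<in>P. 1 + \<theta> / real p))"
    using insert.hyps by (simp add: cardT) (simp add: algebra_simps)
  also have "(real m + 1) * (1 + \<theta> / real p) = real m + 1 + 2 * real m / real p"
    by (simp add: \<theta>_def distrib_left)
  also have "\<dots> * (real (card S) * (\<Prod>p\<in>P. 1 + \<theta> / real p)) \<le> 
     (\<Sum>i\<le>m. \<Sum>j\<le>m. real p ^ (2 * min i j) / real p ^ (i + j)) * gcd_sum S"
    using p S by (intro mult_mono local_gcd_sum sum_nonneg mult_nonneg_nonneg prod_nonneg)
       (auto simp: \<theta>_def prime_gt_0_nat)
  also have "\<dots> = gcd_sum T" unfolding T_def using gcd_sum_prime_power_mult[OF p nd S(1)] by simp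
  finally have "gcd_sum T \<ge> real (card T) * (\<Prod>p\<in>insert p P. 1 + \<theta> / real p)" .
  moreover have "finite T" "0 \<notin> T" using S p by (auto simp: T_def prime_gt_0_nat)
  moreover have "card T = (m + 1) ^ card (insert p P)" using insert.hyps S(3) by (simp add: cardT)
  moreover have "q \<in> insert p P" if "prime q" "a \<in> T" "q dvd a" for q a
  proof -
    from that obtain i b where b: "a = p ^ i * b" "b \<in> S" by (auto simp: T_def)
    with that have "q dvd p ^ i \<or> q dvd b" by (simp add: prime_dvd_mult_iff)
    then show ?thesis
    proof
      assume "q dvd p ^ i"
      then have "q = p" using that(1) p prime_dvd_power primes_dvd_imp_eq by blast
      then show ?thesis by simp
    next
      assume "q dvd b"
      then show ?thesis using S(4) b(2) that(1) by blast
    qed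
  qed
  ultimately show ?case unfolding \<theta>_def by blast
qed

section \<open>Lower bounds for products over primes\<close>

text \<open>Splitting off the full power of \<open>p\<close> maps the sum into a product of a
  geometric sum and the sum for the remaining primes. The exponent is at most \<open>y\<close>,
  since it is smaller than the prime power dividing \<open>n\<close>.\<close>

lemma smooth_harmonic_sum:
  assumes "finite P" "\<And>p. p \<in> P \<Longrightarrow> prime p"
  shows "(\<Sum>n\<in>{n\<in>{1..y}. prime_factors n \<subseteq> P}. 1 / real n) \<le> (\<Prod>p\<in>P. 1 / (1 - 1 / real p))"
  using assms
proof (induction P rule: finite_induct)
  case empty
  have "{n\<in>{1..y}. prime_factors n \<subseteq> {}} \<subseteq> {1}"
    by (auto simp: prime_factorization_empty_iff)
  then have "(\<Sum>n\<in>{n\<in>{1..y}. prime_factors n \<subseteq> {}}. 1 / real n) \<le> (\<Sum>n\<in>{1}. 1 / real n)"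
    by (intro sum_mono2) auto
  then show ?case by simp
next
  case (insert p P)
  have p: "prime p" using insert by auto
  let ?A = "\<lambda>P. {n\<in>{1..y}. prime_factors n \<subseteq> P}"
  have "?A (insert p P) \<subseteq> (\<lambda>(i, k). p ^ i * k) ` ({..y} \<times> ?A P)"
  proof
    fix n assume n: "n \<in> ?A (insert p P)"
    then have "n \<noteq> 0" by auto
    obtain k where k: "n = p ^ multiplicity p n * k" "\<not> p dvd k"
      using multiplicity_decompose'[of n p] p \<open>n \<noteq> 0\<close> by (metis not_prime_unit)
    have "k dvd n" using k by (metis dvd_triv_right)
    have "q \<in> P" if "q \<in> prime_factors k" for q
    proof -
      have "prime q" "q dvd k" using that by auto
      then have "q \<noteq> p" "q \<in> prime_factors n"
        using k(2) \<open>k dvd n\<close> \<open>n \<noteq> 0\<close> by (auto simp: prime_factors_dvd)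
      then show ?thesis using n by auto
    qed
    moreover have "k \<noteq> 0" using k(2) by (metis dvd_0_right)
    ultimately have "k \<in> ?A P"
      using n k(2) dvd_imp_le[OF \<open>k dvd n\<close>] by (auto intro: gr0I)
    moreover have "multiplicity p n \<le> y"
    proof -
      have "p ^ multiplicity p n \<le> n" using \<open>n \<noteq> 0\<close> by (intro dvd_imp_le multiplicity_dvd) auto
      moreover have "multiplicity p n < p ^ multiplicity p n"
        using p by (intro power_gt_expt) (simp add: prime_gt_Suc_0_nat[unfolded])
      ultimately show ?thesis using n by auto
    qed
    ultimately show "n \<in> (\<lambda>(i, k). p ^ i * k) ` ({..y} \<times> ?A P)"
      using k(1) by (intro image_eqI[of _ _ "(multiplicity p n, k)"]) auto
  qed
  then have "(\<Sum>n\<in>?A (insert p P). 1 / real n) \<le> (\<Sum>n\<in>(\<lambda>(i, k). p ^ i * k) ` ({..y} \<times> ?A P). 1 / real n)"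
    by (intro sum_mono2) auto
  also have "\<dots> \<le> sum ((\<lambda>n. 1 / real n) \<circ> (\<lambda>(i, k). p ^ i * k)) ({..y} \<times> ?A P)"
    by (intro sum_image_le) auto
  also have "\<dots> = (\<Sum>i\<le>y. (1 / real p) ^ i) * (\<Sum>n\<in>?A P. 1 / real n)"
    by (simp add: sum.cartesian_product' sum_product case_prod_beta power_one_over comp_def)
  also have "(\<Sum>i\<le>y. (1 / real p) ^ i) \<le> 1 / (1 - 1 / real p)"
  proof -
    have "(\<Sum>i\<le>y. (1 / real p) ^ i) \<le> (\<Sum>i. (1 / real p) ^ i)"
      using prime_gt_1_nat[OF p] by (intro sum_le_suminf summable_geometric) auto
    also have "\<dots> = 1 / (1 - 1 / real p)" using prime_gt_1_nat[OF p] by (intro suminf_geometric) auto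
    finally show ?thesis .
  qed
  also have "1 / (1 - 1 / real p) * (\<Sum>n\<in>?A P. 1 / real n) \<le> 1 / (1 - 1 / real p) * (\<Prod>p\<in>P. 1 / (1 - 1 / real p))"
    using insert prime_gt_1_nat[OF p] by (intro mult_left_mono) auto
  finally show ?case using insert by (auto simp: sum_nonneg mult_right_mono)
qed

text \<open>All prime factors of an integer up to \<open>y\<close> are at most \<open>y\<close>, so
  the Euler product dominates the whole harmonic number.\<close>

lemma euler_product_ge_ln:
  "ln (real y + 1) \<le> (\<Prod>p | prime p \<and> p \<le> y. 1 / (1 - 1 / real p))"
proof -
  let ?P = "{p. prime p \<and> p \<le> y}"
  have "ln (real y + 1) \<le> harm y" by (rule ln_le_harm)
  also have "harm y = (\<Sum>n\<in>{n\<in>{1..y}. prime_factors n \<subseteq> ?P}. 1 / real n)"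
    unfolding harm_def by (intro sum.cong) (auto simp: inverse_eq_divide prime_factors_dvd intro: order_trans[OF dvd_imp_le])
  also have "\<dots> \<le> (\<Prod>p\<in>?P. 1 / (1 - 1 / real p))"
    by (rule smooth_harmonic_sum) auto
  finally show ?thesis .
qed

text \<open>Compare \<open>1 + \<theta> / p\<close> with the Euler factor raised to
  \<open>\<theta>\<close>. Their logarithms differ by at most \<open>8 / p ^ 2\<close>: since
  \<open>\<theta> \<le> 2\<close>, each of the two second-order terms costs at most
  \<open>4 / p ^ 2\<close>. The reciprocal squares sum to at most 1, whence
  \<open>exp (-8)\<close>.\<close>

lemma prod_one_plus_prime_ge:
  assumes "0 \<le> \<theta>" "\<theta> \<le> 2" "y \<ge> 1"
  shows "exp (-8) * ln (real y + 1) powr \<theta> \<le> (\<Prod>p | prime p \<and> p \<le> y. 1 + \<theta> / real p)"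
proof -
  let ?P = "{p. prime p \<and> p \<le> y}"
  have fin: "finite ?P" by simp
  have factor: "\<theta> * ln (1 / (1 - 1 / real p)) - 8 * (1 / real p ^ 2) \<le> ln (1 + \<theta> / real p)" if "p \<in> ?P" for p
  proof -
    have p: "real p \<ge> 2" using that prime_ge_2_nat by auto
    have "- (1 / real p) - 2 * (1 / real p)\<^sup>2 \<le> ln (1 - 1 / real p)"
      using p by (intro ln_one_minus_pos_lower_bound) (auto simp: field_simps)
    then have "ln (1 / (1 - 1 / real p)) \<le> 1 / real p + 2 * (1 / real p)\<^sup>2"
      using p by (simp add: ln_div)
    then have "\<theta> * ln (1 / (1 - 1 / real p)) \<le> \<theta> * (1 / real p + 2 * (1 / real p)\<^sup>2)"
      using assms by (intro mult_left_mono)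
    also have "\<dots> = \<theta> / real p + 2 * \<theta> * (1 / real p ^ 2)" by (simp add: distrib_left power_one_over)
    also have "2 * \<theta> * (1 / real p ^ 2) \<le> 4 * (1 / real p ^ 2)" using assms by (intro mult_right_mono) auto
    finally have 1: "\<theta> * ln (1 / (1 - 1 / real p)) \<le> \<theta> / real p + 4 * (1 / real p ^ 2)" by simp
    have "\<theta> / real p - (\<theta> / real p)\<^sup>2 \<le> ln (1 + \<theta> / real p)"
      using p assms by (intro ln_one_plus_pos_lower_bound) (auto simp: field_simps)
    moreover have "(\<theta> / real p)\<^sup>2 \<le> 4 * (1 / real p ^ 2)"
    proof -
      have "\<theta>\<^sup>2 \<le> 2\<^sup>2" using assms by (intro power_mono)
      then show ?thesis by (simp add: power_divide divide_right_mono)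
    qed
    ultimately show ?thesis using 1 by simp
  qed
  \<comment> \<open>The form \<open>1 - 1 / y\<close> makes the induction telescope.\<close>
  have sq: "(\<Sum>n=2..y. 1 / real n ^ 2) \<le> 1 - 1 / real y"
    using assms(3)
  proof (induction y rule: dec_induct)
    case (step n)
    then have "1 / real (Suc n) ^ 2 \<le> 1 / (real n * real (Suc n))"
      unfolding power2_eq_square by (intro divide_left_mono mult_right_mono) auto
    also have "\<dots> = 1 / real n - 1 / real (Suc n)" using step by (simp add: field_simps)
    finally have "1 / real (Suc n) ^ 2 \<le> 1 / real n - 1 / real (Suc n)" .
    with step show ?case by simp
  qed simp
  have "(\<Sum>p\<in>?P. 1 / real p ^ 2) \<le> (\<Sum>n=2..y. 1 / real n ^ 2)"
    using prime_ge_2_nat by (intro sum_mono2) auto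
  also have "\<dots> \<le> 1 - 1 / real y" by (rule sq)
  also have "\<dots> \<le> 1" by simp
  finally have sq: "(\<Sum>p\<in>?P. 1 / real p ^ 2) \<le> 1" .
  define E where "E = (\<Prod>p\<in>?P. 1 / (1 - 1 / real p))"
  have pos: "1 / (1 - 1 / real p) > 0" if "p \<in> ?P" for p using that prime_gt_1_nat[of p] by auto
  have E: "E > 0" unfolding E_def by (rule prod_pos[OF pos])
  have fpos: "1 + \<theta> / real p > 0" for p :: nat using assms by (simp add: add_pos_nonneg)
  have "exp (-8) * ln (real y + 1) powr \<theta> \<le> exp (-8) * E powr \<theta>"
  proof (intro mult_left_mono powr_mono2)
    show "ln (real y + 1) \<le> E" unfolding E_def by (rule euler_product_ge_ln)
  qed (use assms in auto)
  also have "\<dots> = exp (\<theta> * ln E - 8)"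
    using E by (simp add: powr_def exp_add[symmetric])
  also have "\<dots> \<le> exp (ln (\<Prod>p\<in>?P. 1 + \<theta> / real p))"
  proof -
    have "\<theta> * ln E - 8 \<le> \<theta> * ln E - 8 * (\<Sum>p\<in>?P. 1 / real p ^ 2)" using sq by simp
    also have "\<dots> = (\<Sum>p\<in>?P. \<theta> * ln (1 / (1 - 1 / real p)) - 8 * (1 / real p ^ 2))"
    proof -
      have "ln E = (\<Sum>p\<in>?P. ln (1 / (1 - 1 / real p)))"
        unfolding E_def by (rule ln_prod[OF fin]) (use pos in fastforce)
      then show ?thesis by (simp only: sum_distrib_left sum_subtractf)
    qed
    also have "\<dots> \<le> (\<Sum>p\<in>?P. ln (1 + \<theta> / real p))" by (intro sum_mono factor)
    also have "\<dots> = ln (\<Prod>p\<in>?P. 1 + \<theta> / real p)"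
      by (rule ln_prod[OF fin, symmetric]) (use fpos in \<open>simp add: less_imp_neq[symmetric]\<close>)
    finally show ?thesis by simp
  qed
  also have "\<dots> = (\<Prod>p\<in>?P. 1 + \<theta> / real p)"
    by (intro exp_ln prod_pos fpos)
  finally show ?thesis .
qed

text \<open>There are at most \<open>y\<close> primes up to \<open>y\<close>. This crude count
  suffices, because the upper bound on \<open>card S\<close> is later used only inside a double
  logarithm.\<close>

theorem large_gcd_sum:
  assumes "y \<ge> 1"
  shows "\<exists>S. finite S \<and> S \<noteq> {} \<and> 0 \<notin> S \<and> card S \<le> (m + 1) ^ y \<and>
    gcd_sum S \<ge> real (card S) * (exp (-8) * ln (real y + 1) powr (2 * real m / (real m + 1)))"
proof -
  let ?P = "{p. prime p \<and> p \<le> y}" and ?\<theta> = "2 * real m / (real m + 1)"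
  have "finite ?P" "\<And>p. p \<in> ?P \<Longrightarrow> prime p" by auto
  from gcd_sum_prime_product[OF this, of m] obtain S where S: "finite S" "0 \<notin> S" "card S = (m + 1) ^ card ?P"
    "gcd_sum S \<ge> real (card S) * (\<Prod>p\<in>?P. 1 + ?\<theta> / real p)"
    by blast
  have "card ?P \<le> card {1..y}" using prime_ge_1_nat by (intro card_mono) auto
  then have "card S \<le> (m + 1) ^ y" unfolding S(3) by (intro power_increasing) auto
  moreover have "S \<noteq> {}" using S(3) by auto
  moreover have "real (card S) * (exp (-8) * ln (real y + 1) powr ?\<theta>) \<le> real (card S) * (\<Prod>p\<in>?P. 1 + ?\<theta> / real p)"
    using assms by (intro mult_left_mono prod_one_plus_prime_ge) (auto simp: field_simps)
  ultimately show ?thesis using S by (meson order_trans)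
qed

subsection \<open>Blocks with large sums on a set of fixed measure\<close>

text \<open>Dividing \<open>v\<close> by a bound reduces to the normalised case. The filter form
  allows one \<open>D\<close> to serve several correlations simultaneously.\<close>

lemma mixing_bper:
  assumes "bper u" "bper v" "e > 0"
  shows "\<forall>\<^sub>F D in sequentially. \<bar>mean (\<lambda>x. u x * v (real D * x)) - mean u * mean v\<bar> \<le> e"
proof -
  obtain B where B: "B > 0" "\<And>x. \<bar>v x\<bar> \<le> B" using bper_bound[OF assms(2)] by metis
  have mix: "mixing u" using assms by (intro integrable_mixing) simp
  have "e / B > 0" using assms B by simp
  then obtain D0 where D0: "\<And>D w. D \<ge> D0 \<Longrightarrow> bper w \<Longrightarrow> (\<And>x. \<bar>w x\<bar> \<le> 1) \<Longrightarrow>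
        \<bar>mean (\<lambda>x. u x * w (real D * x)) - mean u * mean w\<bar> \<le> e / B"
    using mix unfolding mixing_def by metis
  have "\<bar>mean (\<lambda>x. u x * v (real D * x)) - mean u * mean v\<bar> \<le> e" if "D \<ge> D0" for D
  proof -
    have "bper (\<lambda>x. v x * (1 / B))" by (intro bper_mult assms bper_const)
    moreover have "\<bar>v x * (1 / B)\<bar> \<le> 1" for x using B(2)[of x] B(1) by (simp add: abs_mult)
    ultimately have "\<bar>mean (\<lambda>x. u x * (v (real D * x) * (1 / B))) - mean u * mean (\<lambda>x. v x * (1 / B))\<bar> \<le> e / B"
      using D0[OF that] by blast
    also have "mean (\<lambda>x. u x * (v (real D * x) * (1 / B))) - mean u * mean (\<lambda>x. v x * (1 / B))
       = (mean (\<lambda>x. u x * v (real D * x)) - mean u * mean v) / B"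
      by (simp add: diff_divide_distrib)
    finally show ?thesis using B by (simp add: abs_divide divide_le_cancel)
  qed
  then show ?thesis by (auto simp: eventually_sequentially)
qed

section \<open>Moments of sums of dilated sawtooth functions\<close>

definition psi :: "nat set \<Rightarrow> real \<Rightarrow> real" where
  "psi T x = (\<Sum>n\<in>T. varphi (real n * x))"

lemma bper_psi [simp]: "bper (psi T)"
  unfolding psi_def by (intro bper_sum bper_dilate bper_varphi)

lemma psi_dilate: 
  assumes "D > 0" shows "psi ((*) D ` T) x = psi T (real D * x)"
proof -
  have "inj_on ((*) D) T" using assms by (auto simp: inj_on_def)
  then show ?thesis unfolding psi_def by (simp add: sum.reindex) (simp add: mult_ac)
qed

lemma mean_psi:
  assumes "0 \<notin> T" shows "mean (psi T) = 0"
proof -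
  have "mean (psi T) = (\<Sum>n\<in>T. mean (\<lambda>x. varphi (real n * x)))"
    unfolding psi_def by (intro Bochner_Integration.integral_sum) simp
  also have "\<dots> = 0" using assms mean_dilate[OF bper_varphi]
    by (intro sum.neutral) (metis mean_varphi neq0_conv)
  finally show ?thesis .
qed

lemma mean_psi_sq:
  assumes "0 \<notin> T" shows "mean (\<lambda>x. psi T x ^ 2) = gcd_sum T / 12"
proof -
  have "mean (\<lambda>x. psi T x ^ 2) = mean (\<lambda>x. \<Sum>a\<in>T. \<Sum>b\<in>T. varphi (real a * x) * varphi (real b * x))"
    by (simp add: psi_def power2_eq_square sum_product)
  also have "\<dots> = (\<Sum>a\<in>T. \<Sum>b\<in>T. mean (\<lambda>x. varphi (real a * x) * varphi (real b * x)))"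
    by (subst Bochner_Integration.integral_sum, simp, intro sum.cong refl Bochner_Integration.integral_sum) simp
  also have "\<dots> = (\<Sum>a\<in>T. \<Sum>b\<in>T. real (gcd a b) ^ 2 / (real a * real b) / 12)"
    using assms by (intro sum.cong refl, subst mean_varphi_mult) (auto intro: gr0I simp: field_simps)
  finally show ?thesis by (simp add: gcd_sum_def sum_divide_distrib)
qed

lemma psi_bound: "\<bar>psi T x\<bar> \<le> real (card T)"
proof -
  have "\<bar>varphi z\<bar> \<le> 1" for z using varphi_bound[of z] by linarith
  then show ?thesis unfolding psi_def
    using sum_norm_bound[of T "\<lambda>n. varphi (real n * x)" 1] by simp
qed

text \<open>The diagonal terms alone contribute this much.\<close>

lemma card_le_gcd_sum:
  assumes "finite S" "0 \<notin> S" shows "real (card S) \<le> gcd_sum S"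
proof -
  have "(\<Sum>a\<in>S. real (gcd a a) ^ 2 / (real a * real a)) = (\<Sum>a\<in>S. 1)"
    using assms(2) by (intro sum.cong refl) (auto simp: power2_eq_square intro!: gr0I)
  then have "real (card S) = (\<Sum>a\<in>S. real (gcd a a) ^ 2 / (real a * real a))" by simp
  also have "\<dots> \<le> gcd_sum S" unfolding gcd_sum_def
    using assms(1) by (intro sum_mono member_le_sum) auto
  finally show ?thesis .
qed

lemma mean_add_sq:
  assumes "bper f" "bper g"
  shows "mean (\<lambda>x. (f x + g x) ^ 2) = mean (\<lambda>x. f x ^ 2) + 2 * mean (\<lambda>x. f x * g x) + mean (\<lambda>x. g x ^ 2)"
proof -
  have "mean (\<lambda>x. (f x + g x) ^ 2) = mean (\<lambda>x. f x ^ 2 + 2 * (f x * g x) + g x ^ 2)"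
    by (simp add: power2_sum algebra_simps)
  then show ?thesis using assms by simp
qed

lemma mean_add_power4:
  assumes "bper f" "bper g"
  shows "mean (\<lambda>x. (f x + g x) ^ 4) = mean (\<lambda>x. f x ^ 4) + 4 * mean (\<lambda>x. f x ^ 3 * g x)
    + 6 * mean (\<lambda>x. f x ^ 2 * g x ^ 2) + 4 * mean (\<lambda>x. f x * g x ^ 3) + mean (\<lambda>x. g x ^ 4)"
proof -
  have "(a + b) ^ 4 = a ^ 4 + 4 * (a ^ 3 * b) + 6 * (a ^ 2 * b ^ 2) + 4 * (a * b ^ 3) + b ^ 4" for a b :: real
    by (simp add: algebra_simps power_numeral_reduce)
  then have "mean (\<lambda>x. (f x + g x) ^ 4) = mean (\<lambda>x. f x ^ 4 + 4 * (f x ^ 3 * g x) + 6 * (f x ^ 2 * g x ^ 2)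
      + 4 * (f x * g x ^ 3) + g x ^ 4)" by simp
  then show ?thesis using assms by simp
qed

text \<open>\<open>T\<close> is a union of \<open>j\<close> dilates \<open>D\<^sub>i S\<close> with rapidly increasing \<open>D\<^sub>i\<close>, so that
  \<open>psi T\<close> behaves like a sum of \<open>j\<close> independent copies of \<open>psi S\<close>.\<close>
lemma sum_of_dilates_moments:
  assumes S: "finite S" "0 \<notin> S" "S \<noteq> {}"
  defines "v \<equiv> mean (\<lambda>x. psi S x ^ 2)"
  shows "\<exists>T. finite T \<and> 0 \<notin> T \<and> card T = j * card S \<and>
    real j * v / 2 \<le> mean (\<lambda>x. psi T x ^ 2) \<and> mean (\<lambda>x. psi T x ^ 2) \<le> 3 * real j * v / 2 \<and>
    mean (\<lambda>x. psi T x ^ 4) \<le> 5 * (real j * v) ^ 2 + real j * v * real (card S) ^ 2"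
proof (induction j)
  case 0
  show ?case by (rule exI[of _ "{}"]) (simp add: psi_def)
next
  case (Suc j)
  then obtain T where T: "finite T" "0 \<notin> T" "card T = j * card S"
    "real j * v / 2 \<le> mean (\<lambda>x. psi T x ^ 2)" "mean (\<lambda>x. psi T x ^ 2) \<le> 3 * real j * v / 2"
    "mean (\<lambda>x. psi T x ^ 4) \<le> 5 * (real j * v) ^ 2 + real j * v * real (card S) ^ 2" by blast
  have "card S > 0" using S by (simp add: card_gt_0_iff)
  then have v: "v > 0" using card_le_gcd_sum[OF S(1,2)] mean_psi_sq[OF S(2)] by (simp add: v_def)
  \<comment> \<open>The cross term \<open>2 * e \<le> v / 2\<close> makes each new copy add between
    \<open>v / 2\<close> and \<open>3 * v / 2\<close> to the second moment. In the fourth moment the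
    mixing errors add up to \<open>(4 + 6 + 4) * e \<le> v ^ 2\<close>.\<close>
  define e where "e = min (v / 4) (v ^ 2 / 14)"
  have e: "e > 0" "e \<le> v / 4" "14 * e \<le> v ^ 2" using v by (auto simp: e_def)
  let ?f = "psi T" and ?g = "psi S"
  have "\<forall>\<^sub>F D in sequentially. \<bar>mean (\<lambda>x. ?f x * ?g (real D * x)) - mean ?f * mean ?g\<bar> \<le> e"
    "\<forall>\<^sub>F D in sequentially. \<bar>mean (\<lambda>x. ?f x ^ 3 * ?g (real D * x)) - mean (\<lambda>x. ?f x ^ 3) * mean ?g\<bar> \<le> e"
    "\<forall>\<^sub>F D in sequentially. \<bar>mean (\<lambda>x. ?f x ^ 2 * ?g (real D * x) ^ 2) - mean (\<lambda>x. ?f x ^ 2) * mean (\<lambda>x. ?g x ^ 2)\<bar> \<le> e"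
    "\<forall>\<^sub>F D in sequentially. \<bar>mean (\<lambda>x. ?f x * ?g (real D * x) ^ 3) - mean ?f * mean (\<lambda>x. ?g x ^ 3)\<bar> \<le> e"
    using e by (auto intro!: mixing_bper mixing_bper[of _ "\<lambda>x. ?g x ^ _"])
  \<comment> \<open>Such a \<open>D\<close> puts the new dilate of \<open>S\<close> beyond all of
    \<open>T\<close>; the inserted 0 covers empty \<open>T\<close> and forces
    \<open>D > 0\<close>.\<close>
  moreover have "\<forall>\<^sub>F D in sequentially. D > Max (insert 0 T)" by (rule eventually_gt_at_top)
  ultimately have "\<forall>\<^sub>F D in sequentially.
      \<bar>mean (\<lambda>x. ?f x * ?g (real D * x)) - mean ?f * mean ?g\<bar> \<le> e \<and>
      \<bar>mean (\<lambda>x. ?f x ^ 3 * ?g (real D * x)) - mean (\<lambda>x. ?f x ^ 3) * mean ?g\<bar> \<le> e \<and>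
      \<bar>mean (\<lambda>x. ?f x ^ 2 * ?g (real D * x) ^ 2) - mean (\<lambda>x. ?f x ^ 2) * mean (\<lambda>x. ?g x ^ 2)\<bar> \<le> e \<and>
      \<bar>mean (\<lambda>x. ?f x * ?g (real D * x) ^ 3) - mean ?f * mean (\<lambda>x. ?g x ^ 3)\<bar> \<le> e \<and> D > Max (insert 0 T)"
    by eventually_elim simp
  then obtain D where "\<bar>mean (\<lambda>x. ?f x * ?g (real D * x)) - mean ?f * mean ?g\<bar> \<le> e"
    "\<bar>mean (\<lambda>x. ?f x ^ 3 * ?g (real D * x)) - mean (\<lambda>x. ?f x ^ 3) * mean ?g\<bar> \<le> e"
    and m22: "\<bar>mean (\<lambda>x. ?f x ^ 2 * ?g (real D * x) ^ 2) - mean (\<lambda>x. ?f x ^ 2) * v\<bar> \<le> e"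
    and "\<bar>mean (\<lambda>x. ?f x * ?g (real D * x) ^ 3) - mean ?f * mean (\<lambda>x. ?g x ^ 3)\<bar> \<le> e"
    and Dmax: "D > Max (insert 0 T)"
    unfolding v_def by (metis (no_types, lifting) eventually_sequentially order_refl)
  then have m11: "\<bar>mean (\<lambda>x. ?f x * ?g (real D * x))\<bar> \<le> e"
    and m31: "\<bar>mean (\<lambda>x. ?f x ^ 3 * ?g (real D * x))\<bar> \<le> e"
    and m13: "\<bar>mean (\<lambda>x. ?f x * ?g (real D * x) ^ 3)\<bar> \<le> e"
    using mean_psi[OF S(2)] mean_psi[OF T(2)] by simp_all
  have D: "D > 0" "\<And>t. t \<in> T \<Longrightarrow> t < D" using Dmax T(1) by auto
  define T' where "T' = T \<union> (*) D ` S"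
  have disj: "T \<inter> (*) D ` S = {}"
  proof -
    have "D * s \<notin> T" if "s \<in> S" for s
    proof -
      have "s \<ge> 1" using that S(2) by (cases s) auto
      then have "D * s \<ge> D" by simp
      then show ?thesis using D(2) by (meson leD)
    qed
    then show ?thesis by auto
  qed
  have "card ((*) D ` S) = card S" using D(1) by (intro card_image) (auto simp: inj_on_def)
  then have "card T' = Suc j * card S" unfolding T'_def using S T disj by (subst card_Un_disjoint) auto
  moreover have "finite T'" "0 \<notin> T'" using S T D by (auto simp: T'_def)
  moreover have psi': "psi T' = (\<lambda>x. ?f x + ?g (real D * x))"
  proof
    fix x
    have "psi T' x = psi T x + psi ((*) D ` S) x"
      unfolding T'_def psi_def using S T disj by (intro sum.union_disjoint) auto
    then show "psi T' x = ?f x + ?g (real D * x)" using psi_dilate[OF D(1)] by simp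
  qed
  moreover have sq: "mean (\<lambda>x. psi T' x ^ 2) = mean (\<lambda>x. ?f x ^ 2) + 2 * mean (\<lambda>x. ?f x * ?g (real D * x)) + v"
    unfolding psi' v_def using mean_dilate[of "\<lambda>x. ?g x ^ 2" D] D by (subst mean_add_sq) auto
  moreover have "mean (\<lambda>x. psi T' x ^ 4) \<le> 5 * (real (Suc j) * v) ^ 2 + real (Suc j) * v * real (card S) ^ 2"
  proof -
    have "mean (\<lambda>x. psi T' x ^ 4) = mean (\<lambda>x. ?f x ^ 4) + 4 * mean (\<lambda>x. ?f x ^ 3 * ?g (real D * x))
      + 6 * mean (\<lambda>x. ?f x ^ 2 * ?g (real D * x) ^ 2) + 4 * mean (\<lambda>x. ?f x * ?g (real D * x) ^ 3) + mean (\<lambda>x. ?g x ^ 4)"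
      unfolding psi' using mean_dilate[of "\<lambda>x. ?g x ^ 4" D] D by (subst mean_add_power4) auto
    \<comment> \<open>The fourth moment of a single copy is only estimated by the supremum bound
      times the second moment.\<close>
    also have "mean (\<lambda>x. ?g x ^ 4) \<le> mean (\<lambda>x. real (card S) ^ 2 * ?g x ^ 2)"
    proof (intro integral_mono)
      fix x
      have "?g x ^ 2 \<le> real (card S) ^ 2" using power_mono[OF psi_bound[of S x], of 2] by simp
      then have "?g x ^ 2 * ?g x ^ 2 \<le> real (card S) ^ 2 * ?g x ^ 2" by (intro mult_right_mono) auto
      then show "?g x ^ 4 \<le> real (card S) ^ 2 * ?g x ^ 2" by (simp add: power_add[symmetric])
    qed simp_all
    also have "\<dots> = real (card S) ^ 2 * v" by (simp add: v_def)
    also have "mean (\<lambda>x. ?f x ^ 2 * ?g (real D * x) ^ 2) \<le> 3 * real j * v / 2 * v + e"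
      using m22 mult_right_mono[OF T(5), of v] v by linarith
    finally have bound4: "mean (\<lambda>x. psi T' x ^ 4) \<le> mean (\<lambda>x. ?f x ^ 4) + 4 * mean (\<lambda>x. ?f x ^ 3 * ?g (real D * x))
      + 6 * (3 * real j * v / 2 * v + e) + 4 * mean (\<lambda>x. ?f x * ?g (real D * x) ^ 3) + real (card S) ^ 2 * v" by simp
    have "mean (\<lambda>x. psi T' x ^ 4) \<le> mean (\<lambda>x. ?f x ^ 4) + 14 * e + 9 * real j * v ^ 2 + real (card S) ^ 2 * v"
    proof -
      have "6 * (3 * real j * v / 2 * v + e) = 9 * real j * v ^ 2 + 6 * e" by (simp add: power2_eq_square)
      then show ?thesis using bound4 m31 m13 by linarith
    qed
    also have "\<dots> \<le> 5 * (real j * v) ^ 2 + real j * v * real (card S) ^ 2 + v ^ 2 + 9 * real j * v ^ 2 + real (card S) ^ 2 * v"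
      using T(6) e by simp
    \<comment> \<open>The increment of \<open>5 * j ^ 2\<close> is \<open>10 * j + 5\<close>, which
      covers \<open>9 * j\<close> from the mixed squares (\<open>6 * 3 / 2\<close>) and 1 from the
      mixing errors.\<close>
    also have "\<dots> \<le> 5 * (real (Suc j) * v) ^ 2 + real (Suc j) * v * real (card S) ^ 2"
    proof -
      have "5 * (real (Suc j) * v) ^ 2 = 5 * (real j * v) ^ 2 + 10 * real j * v ^ 2 + 5 * v ^ 2"
        by (simp add: power2_eq_square algebra_simps)
      moreover have "9 * real j * v ^ 2 \<le> 10 * real j * v ^ 2" by (intro mult_right_mono) auto
      moreover have "v ^ 2 \<le> 5 * v ^ 2" by simp
      moreover have "real (Suc j) * v * real (card S) ^ 2 = real j * v * real (card S) ^ 2 + real (card S) ^ 2 * v"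
        by (simp add: algebra_simps)
      ultimately show ?thesis by linarith
    qed
    finally show ?thesis .
  qed
  moreover have "real (Suc j) * v / 2 \<le> mean (\<lambda>x. psi T' x ^ 2)" "mean (\<lambda>x. psi T' x ^ 2) \<le> 3 * real (Suc j) * v / 2"
    unfolding sq using T(4,5) m11 e v by (auto simp: abs_le_iff distrib_right)
  ultimately show ?case by blast
qed

text \<open>Integrating a pointwise bound for \<open>h ^ 2\<close> gives
  \<open>1 / 2 \<le> 1 / 4 + 12 * \<mu> + 6 / 48\<close>, where \<open>\<mu>\<close> is the measure
  sought; hence \<open>\<mu> \<ge> 1 / 96\<close>.\<close>

lemma paley_zygmund:
  assumes "bper h" "1 / 2 \<le> mean (\<lambda>x. h x ^ 2)" "mean (\<lambda>x. h x ^ 4) \<le> 6"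
  shows "1 / 96 \<le> mean (\<lambda>x. indicator {1/2..} \<bar>h x\<bar>)"
proof -
  let ?A = "\<lambda>x. indicator {1/2..} \<bar>h x\<bar> :: real"
  have eq: "?A = (\<lambda>x. indicator {y. 1/2 \<le> \<bar>y\<bar>} (h x))" by (auto simp: indicator_def)
  have A: "bper ?A" unfolding eq by (rule bper_indicator[OF assms(1)]) measurable
  \<comment> \<open>AM-GM: \<open>12 + h\<^sup>4 / 48 \<ge> h\<^sup>2\<close>\<close>
  have "h x ^ 2 \<le> 1 / 4 + 12 * ?A x + h x ^ 4 * (1 / 48)" for x
  proof (cases "1 / 2 \<le> \<bar>h x\<bar>")
    case True
    have "0 \<le> (h x ^ 2 - 24) ^ 2" by simp
    also have "\<dots> = h x ^ 4 - 48 * h x ^ 2 + 576" by (simp add: power2_eq_square algebra_simps power_numeral_reduce)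
    finally show ?thesis using True by simp
  next
    case False
    then have "\<bar>h x\<bar> ^ 2 \<le> (1 / 2) ^ 2" by (intro power_mono) auto
    then have "h x ^ 2 \<le> 1 / 4" by (simp add: power2_eq_square)
    moreover have "h x ^ 4 * (1 / 48) \<ge> 0" by simp
    moreover have "?A x = 0" using False by simp
    ultimately show ?thesis by linarith
  qed
  then have "mean (\<lambda>x. h x ^ 2) \<le> mean (\<lambda>x. 1 / 4 + 12 * ?A x + h x ^ 4 * (1 / 48))"
    using assms A by (intro integral_mono) auto
  also have "\<dots> = 1 / 4 + 12 * mean ?A + mean (\<lambda>x. h x ^ 4) * (1 / 48)"
    using assms A by simp
  finally show ?thesis using assms by simp
qed

text \<open>For \<open>12 * N\<close> independent copies the second moment would be
  \<open>L = 12 * N * v\<close>. Scaling by \<open>1 / sqrt L\<close> leaves a second moment of at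
  least \<open>1 / 2\<close> and a fourth moment of at most \<open>5 + 1\<close>, as Paley-Zygmund
  requires.\<close>

lemma normalized_block:
  assumes S: "finite S" "0 \<notin> S" "S \<noteq> {}"
  shows "\<exists>T c. finite T \<and> T \<noteq> {} \<and> 0 \<notin> T \<and> card T = 12 * card S ^ 2 \<and>
    c\<^sup>2 * real (card T) = 12 * real (card S) / gcd_sum S \<and>
    1 / 96 \<le> mean (\<lambda>x. indicator {1/2..} \<bar>c * psi T x\<bar>)"
proof -
  define N where "N = card S"
  define v where "v = mean (\<lambda>x. psi S x ^ 2)"
  have N: "N > 0" using S by (simp add: N_def card_gt_0_iff)
  have v: "v = gcd_sum S / 12" "real N \<le> 12 * v"
    using mean_psi_sq[OF S(2)] card_le_gcd_sum[OF S(1,2)] by (auto simp: v_def N_def)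
  \<comment> \<open>With \<open>12 N\<close> copies, \<open>N\<^sup>2 \<le> 12 N v\<close>, which absorbs the term \<open>N\<^sup>2\<close> coming from the fourth moment of a single copy.\<close>
  obtain T where T: "finite T" "0 \<notin> T" "card T = (12 * N) * N"
    "real (12 * N) * v / 2 \<le> mean (\<lambda>x. psi T x ^ 2)"
    "mean (\<lambda>x. psi T x ^ 4) \<le> 5 * (real (12 * N) * v) ^ 2 + real (12 * N) * v * real N ^ 2"
    using sum_of_dilates_moments[OF S, of "12 * N"] unfolding N_def v_def by blast
  define L where "L = real (12 * N) * v"
  have "real N * real N \<le> real N * (12 * v)" using v by (intro mult_left_mono) auto
  then have L: "real N ^ 2 \<le> L" by (simp add: L_def power2_eq_square)
  with N have L0: "L > 0" by (smt (verit) of_nat_0_less_iff zero_less_power)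
  define c where "c = 1 / sqrt L"
  have c2: "c\<^sup>2 = 1 / L" using L0 by (simp add: c_def power_divide)
  then have c4: "c ^ 4 = 1 / L ^ 2" by (metis (no_types, lifting) mult_2 numeral_Bit0 numeral_code(1) power_add power_one_over power2_eq_square)
  have "1 / 96 \<le> mean (\<lambda>x. indicator {1/2..} \<bar>c * psi T x\<bar>)"
  proof (rule paley_zygmund)
    show "1 / 2 \<le> mean (\<lambda>x. (c * psi T x) ^ 2)"
      using T(4)[folded L_def] L0 by (simp add: power_mult_distrib c2 field_simps)
    have "mean (\<lambda>x. psi T x ^ 4) \<le> 5 * L ^ 2 + L * L"
      using T(5) mult_left_mono[OF L, of L] L0 unfolding L_def[symmetric] by linarith
    then show "mean (\<lambda>x. (c * psi T x) ^ 4) \<le> 6"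
      using L0 by (simp add: power_mult_distrib c4 field_simps power2_eq_square)
  qed simp
  moreover have "c\<^sup>2 * real (card T) = 12 * real N / gcd_sum S"
    using N L0 by (simp add: c2 T(3) L_def v(1))
  moreover have "T \<noteq> {}" using T(3) N by auto
  ultimately show ?thesis using T by (intro exI[of _ T] exI[of _ c]) (auto simp: N_def power2_eq_square)
qed

text \<open>Here \<open>K\<close> is the index at which the block will start. With \<open>m\<close>
  fixed, the weight is at most a constant times \<open>ln (y + 1)\<close> to the power
  \<open>\<gamma> - \<theta>\<close>, which tends to 0 as \<open>y\<close> grows.\<close>

lemma cheap_block:
  fixes \<gamma> \<epsilon> :: real and K :: nat
  assumes \<gamma>: "0 < \<gamma>" "\<gamma> < 2" and "\<epsilon> > 0" and K: "K \<ge> 3"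
  shows "\<exists>T c. finite T \<and> T \<noteq> {} \<and> 0 \<notin> T \<and>
    c\<^sup>2 * real (card T) * ln (ln (real (K + card T))) powr \<gamma> \<le> \<epsilon> \<and>
    1 / 96 \<le> mean (\<lambda>x. indicator {1/2..} \<bar>c * psi T x\<bar>)"
proof -
  \<comment> \<open>For \<open>\<gamma> < 2\<close> this is equivalent to
    \<open>\<gamma> < 2 * m / (m + 1)\<close>.\<close>
  obtain m :: nat where m: "\<gamma> / (2 - \<gamma>) < real m" using reals_Archimedean2 by blast
  define \<theta> where "\<theta> = 2 * real m / (real m + 1)"
  have \<theta>: "\<gamma> < \<theta>" using m \<gamma> by (simp add: \<theta>_def field_simps)
  have m1: "m \<ge> 1" using m \<gamma> by (cases m) (auto simp: field_simps)
  \<comment> \<open>Chosen so that \<open>ln (K + card T) \<le> y * C\<close>; hence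
    \<open>y \<ge> C\<close> bounds this logarithm by \<open>y ^ 2\<close>.\<close>
  define C where "C = ln (real K + 12) + 2 * ln (real m + 1)"
  have lim: "(\<lambda>y. 12 * exp 8 * 2 powr \<gamma> * ln (real y + 1) powr (- (\<theta> - \<gamma>))) \<longlonglongrightarrow> 12 * exp 8 * 2 powr \<gamma> * 0"
  proof (intro tendsto_mult tendsto_const tendsto_neg_powr)
    show "filterlim (\<lambda>y. ln (real y + 1)) at_top sequentially"
      using filterlim_compose[OF ln_at_top filterlim_compose[OF filterlim_real_sequentially filterlim_Suc]]
      by (simp add: add.commute)
  qed (use \<theta> in simp)
  have "\<forall>\<^sub>F y in sequentially. 12 * exp 8 * 2 powr \<gamma> * ln (real y + 1) powr (- (\<theta> - \<gamma>)) < \<epsilon>"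
    using order_tendstoD(2)[OF lim] assms by simp
  moreover have "\<forall>\<^sub>F y in sequentially. y \<ge> nat \<lceil>C\<rceil> + 2" by (rule eventually_ge_at_top)
  ultimately have "\<forall>\<^sub>F y in sequentially. 12 * exp 8 * 2 powr \<gamma> * ln (real y + 1) powr (- (\<theta> - \<gamma>)) < \<epsilon> \<and> y \<ge> nat \<lceil>C\<rceil> + 2"
    by eventually_elim simp
  then obtain y where y: "12 * exp 8 * 2 powr \<gamma> * ln (real y + 1) powr (- (\<theta> - \<gamma>)) < \<epsilon>" "y \<ge> nat \<lceil>C\<rceil> + 2"
    by (metis (no_types, lifting) eventually_sequentially order_refl)
  have yC: "real y \<ge> C" "y \<ge> 2" using y(2) by linarith+
  have lny: "ln (real y + 1) > 0" using yC by simp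
  obtain S where S: "finite S" "S \<noteq> {}" "0 \<notin> S" "card S \<le> (m + 1) ^ y"
    "gcd_sum S \<ge> real (card S) * (exp (-8) * ln (real y + 1) powr \<theta>)"
    using large_gcd_sum[of y m] yC unfolding \<theta>_def by auto
  obtain T c where T: "finite T" "T \<noteq> {}" "0 \<notin> T" "card T = 12 * card S ^ 2"
    "c\<^sup>2 * real (card T) = 12 * real (card S) / gcd_sum S"
    "1 / 96 \<le> mean (\<lambda>x. indicator {1/2..} \<bar>c * psi T x\<bar>)"
    using normalized_block[OF S(1,3,2)] by blast
  have N: "card S > 0" using S by (simp add: card_gt_0_iff)
  have KT: "real (K + card T) \<ge> 3" using K by simp
  have "12 * real (card S) / gcd_sum S \<le> 12 * real (card S) / (real (card S) * (exp (-8) * ln (real y + 1) powr \<theta>))"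
  proof (rule divide_left_mono)
    have "gcd_sum S > 0" using card_le_gcd_sum[OF S(1,3)] N by linarith
    moreover have "real (card S) * (exp (-8) * ln (real y + 1) powr \<theta>) > 0"
      using N lny by (intro mult_pos_pos) auto
    ultimately show "0 < gcd_sum S * (real (card S) * (exp (-8) * ln (real y + 1) powr \<theta>))"
      by (rule mult_pos_pos)
  qed (use S(5) in auto)
  also have "\<dots> = 12 * exp 8 * ln (real y + 1) powr (- \<theta>)"
    using N by (simp add: exp_minus powr_minus field_simps)
  finally have c2: "c\<^sup>2 * real (card T) \<le> 12 * exp 8 * ln (real y + 1) powr (- \<theta>)" using T(5) by simp
  have "ln (real (K + card T)) \<le> (real y + 1) ^ 2"
  proof -
    have "real (card S) \<le> real (m + 1) ^ y"
      using S(4) by (metis of_nat_mono of_nat_power)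
    then have "real (card S) ^ 2 \<le> (real (m + 1) ^ y) ^ 2" by (intro power_mono) auto
    moreover have "real K * 1 \<le> real K * (real (m + 1) ^ y) ^ 2" by (intro mult_left_mono one_le_power) auto
    moreover have "real (K + card T) = real K * 1 + 12 * real (card S) ^ 2" by (simp add: T(4))
    ultimately have "real (K + card T) \<le> real K * (real (m + 1) ^ y) ^ 2 + 12 * (real (m + 1) ^ y) ^ 2"
      by linarith
    also have "\<dots> = (real K + 12) * (real m + 1) ^ (y * 2)" by (simp add: distrib_right power_mult add.commute)
    finally have "ln (real (K + card T)) \<le> ln ((real K + 12) * (real m + 1) ^ (y * 2))"
      using KT by (intro ln_mono) auto
    also have "\<dots> = ln (real K + 12) + real y * (2 * ln (real m + 1))"
      by (subst ln_mult) (auto simp: ln_realpow)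
    also have "\<dots> \<le> real y * ln (real K + 12) + real y * (2 * ln (real m + 1))"
      using yC by (intro add_right_mono) (simp add: mult_le_cancel_right1)
    also have "\<dots> = real y * C" by (simp add: C_def distrib_left)
    also have "\<dots> \<le> real y * real y" using yC by (intro mult_left_mono) auto
    also have "\<dots> \<le> (real y + 1) ^ 2" by (simp add: power2_eq_square algebra_simps)
    finally show ?thesis .
  qed
  \<comment> \<open>From index 3 on the double logarithm is nonnegative, so raising it to the power
    \<open>\<gamma>\<close> is monotone.\<close>
  moreover have ln1: "1 \<le> ln (real (K + card T))"
    using KT exp_le by (subst ln_ge_iff) linarith+
  ultimately have "ln (ln (real (K + card T))) \<le> ln ((real y + 1) ^ 2)"
    by (intro ln_mono) auto
  also have "\<dots> = 2 * ln (real y + 1)" by (simp add: ln_realpow)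
  finally have "ln (ln (real (K + card T))) powr \<gamma> \<le> (2 * ln (real y + 1)) powr \<gamma>"
    using \<gamma> ln1 by (intro powr_mono2) auto
  also have "\<dots> = 2 powr \<gamma> * ln (real y + 1) powr \<gamma>" using lny by (simp add: powr_mult)
  finally have "c\<^sup>2 * real (card T) * ln (ln (real (K + card T))) powr \<gamma>
     \<le> (12 * exp 8 * ln (real y + 1) powr (- \<theta>)) * (2 powr \<gamma> * ln (real y + 1) powr \<gamma>)"
    by (rule mult_mono[OF c2]) simp_all
  also have "\<dots> = 12 * exp 8 * 2 powr \<gamma> * ln (real y + 1) powr (- (\<theta> - \<gamma>))"
    by (simp add: powr_add[symmetric])
  also have "\<dots> \<le> \<epsilon>" using y by simp
  finally show ?thesis using T by blast
qed

subsection \<open>Almost every point is hit infinitely often\<close>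

text \<open>The integral over \<open>{- n..<n}\<close> is \<open>2 * n\<close> times the mean, so
  \<open>f\<close> vanishes almost everywhere on each of countably many intervals exhausting the
  line.\<close>

lemma bper_mean_zero_AE:
  assumes "bper f" "\<And>x. f x \<ge> 0" "mean f = 0"
  shows "AE x in lborel. f x = 0"
proof -
  have [measurable]: "f \<in> borel_measurable borel" using assms by (simp add: bper_def)
  have "AE x in lborel. indicator {- real n..<real n} x *\<^sub>R f x = 0" for n
  proof -
    have "(LINT x:{- real n..<real n}|lborel. f x) = (LINT x:{0..<real (2 * n)}|lborel. f x)"
      using set_integral_shift_nat[OF assms(1), of n "- real n" "real n"] by simp
    also have "\<dots> = 0" using set_integral_periods[OF assms(1), of "2 * n"] assms(3) by simp
    finally have "(LINT x|lborel. indicator {- real n..<real n} x *\<^sub>R f x) = 0"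
      by (simp add: set_lebesgue_integral_def)
    moreover have "integrable lborel (\<lambda>x. indicator {- real n..<real n} x *\<^sub>R f x)"
      using bper_set_integrable[OF assms(1)] by (simp add: set_integrable_def)
    ultimately show ?thesis
      using assms(2) by (subst (asm) integral_nonneg_eq_0_iff_AE) auto
  qed
  then have "AE x in lborel. \<forall>n. indicator {- real n..<real n} x *\<^sub>R f x = 0"
    unfolding AE_all_countable by blast
  then show ?thesis
  proof eventually_elim
    case (elim x)
    obtain n :: nat where "\<bar>x\<bar> < real n" using reals_Archimedean2 by blast
    then have "x \<in> {- real n..<real n}" by auto
    with elim show ?case by (metis indicator_simps(1) scaleR_one)
  qed
qed

text \<open>On \<open>Z j\<close>, where no event from index \<open>j\<close> on occurs, the product
  with the \<open>i\<close>-th dilated event vanishes for \<open>i \<ge> j\<close>. Mixing makes its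
  mean close to \<open>mean (Z j) * mean (v i)\<close>, which is at least \<open>\<delta>\<close>
  times the measure of \<open>Z j\<close>; so that measure is 0. Uniformity in \<open>v\<close>
  matters, since \<open>v i\<close> changes together with \<open>E i\<close>.\<close>

lemma bper_mult_infinitely_often:
  fixes v :: "nat \<Rightarrow> real \<Rightarrow> real" and E :: "nat \<Rightarrow> nat"
  assumes v: "\<And>i. bper (v i)" "\<And>i x. v i x \<in> {0, 1}" "\<And>i. \<delta> \<le> mean (v i)"
    and \<delta>: "\<delta> > 0" and E: "strict_mono E"
  shows "AE x in lborel. \<exists>\<^sub>\<infinity>i. v i (real (E i) * x) = 1"
proof -
  define Z where "Z j = {x. \<forall>i\<ge>j. v i (real (E i) * x) = 0}" for j
  have "AE x in lborel. indicat_real (Z j) x = 0" for j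
  proof (rule bper_mean_zero_AE)
    have dil: "bper (\<lambda>x. v i (real (E i) * x))" for i using v(1) by simp
    then have [measurable]: "(\<lambda>x. v i (real (E i) * x)) \<in> borel_measurable borel" for i by (simp add: bper_def)
    show bZ: "bper (indicat_real (Z j))"
    proof (rule bperI[where B = 1])
      have "Z j \<in> sets borel" unfolding Z_def by measurable
      then show "indicat_real (Z j) \<in> borel_measurable borel" by simp
      show "indicat_real (Z j) (x + 1) = indicat_real (Z j) x" for x
        using dil unfolding bper_def Z_def indicator_def by simp
    qed (simp add: indicator_def)
    have mix: "mixing (indicat_real (Z j))" using bZ by (intro integrable_mixing) simp
    have mZ: "0 \<le> mean (indicat_real (Z j))" by (intro integral_nonneg_AE) auto
    have "mean (indicat_real (Z j)) \<le> e" if "e > 0" for e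
    proof -
      have "\<delta> * e > 0" using that \<delta> by simp
      then obtain D0 where D0: "\<And>D w. D \<ge> D0 \<Longrightarrow> bper w \<Longrightarrow> (\<And>x. \<bar>w x\<bar> \<le> 1) \<Longrightarrow>
        \<bar>mean (\<lambda>x. indicat_real (Z j) x * w (real D * x)) - mean (indicat_real (Z j)) * mean w\<bar> \<le> \<delta> * e"
        using mix unfolding mixing_def by metis
      \<comment> \<open>Beyond \<open>j\<close> the product vanishes; beyond \<open>D0\<close>
        mixing applies, because \<open>E i \<ge> i\<close>.\<close>
      define i where "i = max j D0"
      have "E i \<ge> D0" using seq_suble[OF E, of i] by (simp add: i_def)
      moreover have "\<bar>v i x\<bar> \<le> 1" for x using v(2)[of i x] by auto
      ultimately have "\<bar>mean (\<lambda>x. indicat_real (Z j) x * v i (real (E i) * x)) - mean (indicat_real (Z j)) * mean (v i)\<bar> \<le> \<delta> * e"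
        using D0 v(1) by blast
      moreover have "(\<lambda>x. indicat_real (Z j) x * v i (real (E i) * x)) = (\<lambda>x. 0)"
      proof
        fix x
        have "v i (real (E i) * x) = 0" if "x \<in> Z j" using that unfolding Z_def i_def by simp
        then show "indicat_real (Z j) x * v i (real (E i) * x) = 0" by (simp add: indicator_def)
      qed
      ultimately have "mean (indicat_real (Z j)) * mean (v i) \<le> \<delta> * e" by simp
      moreover have "mean (indicat_real (Z j)) * \<delta> \<le> mean (indicat_real (Z j)) * mean (v i)"
        using mZ v(3) by (intro mult_left_mono)
      ultimately have "\<delta> * mean (indicat_real (Z j)) \<le> \<delta> * e" by (simp add: mult.commute)
      then show ?thesis using \<delta> by simp
    qed
    then have "mean (indicat_real (Z j)) \<le> 0" using field_le_epsilon[of "mean (indicat_real (Z j))" 0] by simp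
    with mZ show "mean (indicat_real (Z j)) = 0" by (rule antisym[rotated])
  qed simp
  then have "AE x in lborel. \<forall>j. indicat_real (Z j) x = 0" by (simp add: AE_all_countable)
  then show ?thesis
  proof eventually_elim
    case (elim x)
    show ?case unfolding INFM_nat_le
    proof
      fix j
      have "x \<notin> Z j" using elim by (simp add: indicator_eq_0_iff)
      then obtain i where "i \<ge> j" "v i (real (E i) * x) \<noteq> 0" by (auto simp: Z_def)
      then show "\<exists>i\<ge>j. v i (real (E i) * x) = 1" using v(2)[of i "real (E i) * x"] by auto
    qed
  qed
qed

subsection \<open>Concatenation of the blocks\<close>

theorem theorem7:
  fixes \<gamma> :: real
  assumes "0 < \<gamma>" and "\<gamma> < 2"
  shows "\<exists>(n :: nat \<Rightarrow> nat) (c :: nat \<Rightarrow> real).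
           strict_mono_on {1..} n \<and> (\<forall>k\<ge>1. 0 < n k) \<and>
           summable (\<lambda>k. (c (k + 3))\<^sup>2 * ln (ln (real (k + 3))) powr \<gamma>) \<and>
           (AE x in lebesgue. \<not> summable (\<lambda>k. c (k + 1) * varphi (real (n (k + 1)) * x)))"
proof -
  have "\<exists>T a. finite T \<and> T \<noteq> {} \<and> 0 \<notin> T \<and>
      a\<^sup>2 * real (card T) * ln (ln (real (K + card T))) powr \<gamma> \<le> (1 / 2) ^ i \<and>
      1 / 96 \<le> mean (\<lambda>x. indicator {1/2..} \<bar>a * psi T x\<bar>)" if "K \<ge> 3" for K i
    using cheap_block[OF assms _ that, of "(1 / 2) ^ i"] by simp
  then obtain Tf af where Tf: "\<And>K i. K \<ge> 3 \<Longrightarrow> finite (Tf K i) \<and> Tf K i \<noteq> {} \<and> 0 \<notin> Tf K i \<and>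
      (af K i)\<^sup>2 * real (card (Tf K i)) * ln (ln (real (K + card (Tf K i)))) powr \<gamma> \<le> (1 / 2) ^ i \<and>
      1 / 96 \<le> mean (\<lambda>x. indicator {1/2..} \<bar>af K i * psi (Tf K i) x\<bar>)"
    by metis

  \<comment> \<open>\<open>K i\<close> is the first index of block \<open>i\<close>. Blocks are
    chosen recursively because the weight of a block depends on where it ends. The start 3 keeps the
    double logarithm positive.\<close>
  define K where "K = rec_nat 3 (\<lambda>i k. k + card (Tf k i))"
  define T a where "T i = Tf (K i) i" and "a i = af (K i) i" for i
  have K0: "K 0 = 3" and KSuc: "K (Suc i) = K i + card (T i)" for i
    by (simp_all add: K_def T_def)
  have K3: "K i \<ge> 3" for i by (induction i) (simp_all add: K0 KSuc)
  have T: "finite (T i)" "T i \<noteq> {}" "0 \<notin> T i"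
    "(a i)\<^sup>2 * real (card (T i)) * ln (ln (real (K (Suc i)))) powr \<gamma> \<le> (1 / 2) ^ i"
    "1 / 96 \<le> mean (\<lambda>x. indicator {1/2..} \<bar>a i * psi (T i) x\<bar>)" for i
    using Tf[OF K3[of i], of i] unfolding T_def[symmetric] a_def[symmetric] KSuc by auto
  have "strict_mono K" using T(1,2) by (simp add: strict_mono_Suc_iff KSuc card_gt_0_iff)
  then have K_mono: "mono K" and K_ge: "i \<le> K i" for i
    by (simp_all add: strict_mono_mono seq_suble)

  \<comment> \<open>The next dilation factor exceeds \<open>E i * Max (T i)\<close>, the largest
    frequency of block \<open>i\<close>, so successive blocks have increasing frequencies. The start
    3 leaves room for the values 0, 1, 2 below the first block.\<close>
  define E where "E = rec_nat 3 (\<lambda>i e. Suc (e * Max (T i)))"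
  define U where "U i = (*) (E i) ` T i" for i
  have E0: "E 0 = 3" and ESuc: "E (Suc i) = Suc (E i * Max (T i))" for i by (simp_all add: E_def)
  have T_pos: "t > 0" if "t \<in> T i" for t i using that T(3)[of i] by (auto intro: gr0I)
  have "E i < E (Suc i)" for i
    using T_pos[OF Max_in[OF T(1,2)], of i] by (simp add: ESuc less_Suc_eq_le)
  then have E_mono: "strict_mono E" by (simp add: strict_mono_Suc_iff)
  have E3: "E i \<ge> 3" for i using strict_mono_less_eq[OF E_mono, of 0 i] E0 by simp
  have U_fin: "finite (U i)" and U_card: "card (U i) = card (T i)" for i
    using T(1) E3[of i] by (auto simp: U_def intro!: card_image inj_onI)
  have U_lower: "E i \<le> u" if "u \<in> U i" for u i
    using that T_pos by (force simp: U_def Suc_leI)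
  have U_upper: "u < E (Suc i)" if "u \<in> U i" for u i
    using that T(1) by (auto simp: U_def ESuc less_Suc_eq_le)

  \<comment> \<open>The number of the block that contains index \<open>k\<close>.\<close>
  define b where "b k = (GREATEST i. K i \<le> k)" for k
  have b_eqI: "b k = i" if "K i \<le> k" "k < K (Suc i)" for i k
    unfolding b_def
  proof (rule Greatest_equality)
    fix j assume "K j \<le> k"
    with that have "K j < K (Suc i)" by simp
    then show "j \<le> i" using \<open>strict_mono K\<close> by (simp add: strict_mono_less less_Suc_eq_le)
  qed (rule that)
  have b_ex: "\<exists>i. K i \<le> k \<and> k < K (Suc i)" if "k \<ge> 3" for k
  proof -
    define i where "i = (LEAST i. k < K i)"
    have ex: "k < K (Suc k)" using K_ge[of "Suc k"] by simp
    then have "k < K i" unfolding i_def by (rule LeastI)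
    moreover from this that have "i \<noteq> 0" using K0 by (metis not_less)
    then obtain j where "i = Suc j" by (cases i) auto
    moreover from this have "\<not> k < K j" unfolding i_def by (metis lessI not_less_Least)
    ultimately show ?thesis by (auto simp: not_less)
  qed

  \<comment> \<open>Indices below 3, where \<open>ln (ln k)\<close> is negative or junk, carry no block and get coefficient 0.\<close>
  define n where "n k = (if k < 3 then k else sorted_list_of_set (U (b k)) ! (k - K (b k)))" for k
  define c where "c k = (if k < 3 then 0 else a (b k))" for k
  have n_block: "n (K i + l) = sorted_list_of_set (U i) ! l" and c_block: "c (K i + l) = a i"
    if "l < card (T i)" for i l
    using that b_eqI[of i "K i + l"] K3[of i] by (simp_all add: n_def c_def KSuc)
  have n_mem: "n (K i + l) \<in> U i" if "l < card (T i)" for i l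
    using that U_fin[of i] U_card[of i] nth_mem[of l "sorted_list_of_set (U i)"] by (simp add: n_block)

  \<comment> \<open>Four situations: the filler indices, the passage from 2 into block 0, neighbours
    inside a block, and the junction of two blocks.\<close>
  have "n k < n (Suc k)" for k
  proof -
    consider "k < 2" | "k = 2" | "k \<ge> 3" by linarith
    then show ?thesis
    proof cases
      case 1
      then show ?thesis by (simp add: n_def)
    next
      case 2
      have "n (K 0 + 0) \<in> U 0" using T(1,2) by (intro n_mem) (simp add: card_gt_0_iff)
      then have "E 0 \<le> n 3" using U_lower K0 by force
      then show ?thesis using 2 E0 by (simp add: n_def)
    next
      case 3
      then obtain i where i: "K i \<le> k" "k < K (Suc i)" using b_ex by blast
      define l where "l = k - K i"
      have l: "k = K i + l" "l < card (T i)" using i by (auto simp: l_def KSuc)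
      show ?thesis
      proof (cases "Suc l < card (T i)")
        case True
        then have "sorted_list_of_set (U i) ! l < sorted_list_of_set (U i) ! Suc l"
          using U_card[of i] U_fin[of i]
          by (intro sorted_wrt_nth_less[OF strict_sorted_list_of_set]) simp_all
        then show ?thesis using n_block[OF True] n_block[OF l(2)] l(1) by simp
      next
        case False
        then have "Suc k = K (Suc i) + 0" using l by (simp add: KSuc)
        moreover have "n (K (Suc i) + 0) \<in> U (Suc i)" using T(1,2) by (intro n_mem) (simp add: card_gt_0_iff)
        ultimately have "E (Suc i) \<le> n (Suc k)" using U_lower by simp
        moreover have "n k < E (Suc i)" using U_upper n_mem[OF l(2)] l(1) by simp
        ultimately show ?thesis by simp
      qed
    qed
  qed
  then have n_mono: "strict_mono n" by (simp add: strict_mono_Suc_iff)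

  \<comment> \<open>The block enumerates \<open>U i\<close> once with constant coefficient, and the
    common dilation moves into the argument.\<close>
  have block_sum: "(\<Sum>k=K i..<K (Suc i). c k * varphi (real (n k) * x)) = a i * psi (T i) (real (E i) * x)" for i x
  proof -
    have "(\<Sum>k=K i..<K (Suc i). c k * varphi (real (n k) * x))
        = (\<Sum>l<card (T i). c (K i + l) * varphi (real (n (K i + l)) * x))"
      using sum.shift_bounds_nat_ivl[of "\<lambda>k. c k * varphi (real (n k) * x)" 0 "K i" "card (T i)"]
      by (simp add: KSuc add.commute atLeast0LessThan)
    also have "\<dots> = (\<Sum>l<card (T i). a i * varphi (real (sorted_list_of_set (U i) ! l) * x))"
      by (intro sum.cong) (simp_all add: n_block c_block)
    also have "\<dots> = (\<Sum>u\<in>U i. a i * varphi (real u * x))"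
      using U_fin[of i] U_card[of i]
      by (intro sum.reindex_bij_betw bij_betw_nth) auto
    also have "\<dots> = a i * psi (U i) x" by (simp add: psi_def sum_distrib_left)
    also have "psi (U i) x = psi (T i) (real (E i) * x)"
      unfolding U_def using E3[of i] by (intro psi_dilate) simp
    finally show ?thesis .
  qed

  have "summable (\<lambda>k. (c (k + 3))\<^sup>2 * ln (ln (real (k + 3))) powr \<gamma>)"
  proof (rule summableI_nonneg_bounded)
    let ?f = "\<lambda>k. (c k)\<^sup>2 * ln (ln (real k)) powr \<gamma>"
    \<comment> \<open>Inside a block the double logarithm is replaced by its value at the end index,
      for which the block was made cheap.\<close>
    have block: "(\<Sum>k=K i..<K (Suc i). ?f k) \<le> (1 / 2) ^ i" for i
    proof -
      have "?f k \<le> (a i)\<^sup>2 * ln (ln (real (K (Suc i)))) powr \<gamma>" if k: "k \<in> {K i..<K (Suc i)}" for k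
      proof -
        have "c k = a i" using c_block[of "k - K i" i] k by (auto simp: KSuc)
        moreover have "real k \<ge> 3" using K3[of i] k by simp
        then have "ln (real k) \<ge> 1" using exp_le by (subst ln_ge_iff) linarith+
        moreover from \<open>real k \<ge> 3\<close> k have "ln (real k) \<le> ln (real (K (Suc i)))" by (intro ln_mono) auto
        ultimately show ?thesis using assms
          by (intro mult_mono powr_mono2 ln_mono[of "ln (real k)"]) auto
      qed
      then have "(\<Sum>k=K i..<K (Suc i). ?f k) \<le> (\<Sum>k=K i..<K (Suc i). (a i)\<^sup>2 * ln (ln (real (K (Suc i)))) powr \<gamma>)"
        by (rule sum_mono)
      also have "\<dots> = (a i)\<^sup>2 * real (card (T i)) * ln (ln (real (K (Suc i)))) powr \<gamma>" by (simp add: KSuc)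
      also have "\<dots> \<le> (1 / 2) ^ i" by (rule T(4))
      finally show ?thesis .
    qed
    have blocks: "(\<Sum>k=K 0..<K m. ?f k) \<le> (\<Sum>i<m. (1 / 2) ^ i)" for m
    proof (induction m)
      case (Suc m)
      have "(\<Sum>k=K 0..<K (Suc m). ?f k) = (\<Sum>k=K 0..<K m. ?f k) + (\<Sum>k=K m..<K (Suc m). ?f k)"
        by (rule sum.atLeastLessThan_concat[symmetric]) (simp_all add: monoD[OF K_mono])
      with Suc block[of m] show ?case by simp
    qed simp
    fix m
    have "(\<Sum>k<m. ?f (k + 3)) = (\<Sum>k=K 0..<m + 3. ?f k)"
      using sum.shift_bounds_nat_ivl[of ?f 0 3 m] by (simp add: K0 atLeast0LessThan)
    \<comment> \<open>The partial sum is enlarged to whole blocks, using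
      \<open>m + 3 \<le> K (m + 3)\<close>.\<close>
    also have "\<dots> \<le> (\<Sum>k=K 0..<K (m + 3). ?f k)"
      using K_ge[of "m + 3"] by (intro sum_mono2) auto
    also have "\<dots> \<le> (\<Sum>i<m + 3. (1 / 2) ^ i)" by (rule blocks)
    also have "\<dots> \<le> (\<Sum>i. (1 / 2 :: real) ^ i)" by (intro sum_le_suminf summable_geometric) auto
    finally show "(\<Sum>k<m. ?f (k + 3)) \<le> (\<Sum>i. (1 / 2 :: real) ^ i)" .
  qed simp

  moreover have "AE x in lebesgue. \<not> summable (\<lambda>k. c (k + 1) * varphi (real (n (k + 1)) * x))"
  proof -
    define v where "v i x = indicat_real {1/2..} \<bar>a i * psi (T i) x\<bar>" for i x
    have "AE x in lborel. \<exists>\<^sub>\<infinity>i. v i (real (E i) * x) = 1"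
    proof (rule bper_mult_infinitely_often)
      show "bper (v i)" for i
      proof -
        have "v i = (\<lambda>x. indicator {y. 1/2 \<le> \<bar>y\<bar>} (a i * psi (T i) x))" by (auto simp: v_def indicator_def)
        moreover have "bper \<dots>" by (rule bper_indicator) (simp, measurable)
        ultimately show ?thesis by simp
      qed
      show "1 / 96 \<le> mean (v i)" for i unfolding v_def by (rule T(5))
    qed (use E_mono in \<open>auto simp: v_def indicator_def\<close>)
    then have "AE x in lborel. \<not> summable (\<lambda>k. c (k + 1) * varphi (real (n (k + 1)) * x))"
    proof eventually_elim
      case (elim x)
      show ?case
      proof
        let ?g = "\<lambda>k. c k * varphi (real (n k) * x)"
        assume "summable (\<lambda>k. ?g (k + 1))"
        then have "summable ?g" using summable_iff_shift[of ?g 1] by blast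
        then obtain M where M: "\<And>m l. m \<ge> M \<Longrightarrow> norm (sum ?g {m..<l}) < 1 / 2"
          unfolding summable_Cauchy by (metis half_gt_zero_iff zero_less_one)
        from elim obtain i where i: "i \<ge> M" "v i (real (E i) * x) = 1" unfolding INFM_nat_le by blast
        \<comment> \<open>The block lies beyond the Cauchy threshold, since
          \<open>K i \<ge> i \<ge> M\<close>; yet \<open>v i = 1\<close> says that its sum is at
          least \<open>1 / 2\<close> in absolute value.\<close>
        have "\<bar>\<Sum>k=K i..<K (Suc i). ?g k\<bar> < 1 / 2"
          using M[of "K i" "K (Suc i)"] K_ge[of i] i(1) by simp
        then show False using i(2) by (simp add: block_sum v_def indicator_def split: if_splits)
      qed
    qed
    then show ?thesis by (rule AE_completion)
  qed
  moreover have "strict_mono_on {1..} n" using n_mono by (simp add: strict_mono_on_def strict_mono_def)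
  moreover have "\<forall>k\<ge>1. 0 < n k" using seq_suble[OF n_mono] by (meson le_trans less_le_trans zero_less_one)
  ultimately show ?thesis by blast
qed

end
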